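(* Let $C_\lambda, C_\gamma\subset\mathbb{R}$ be the self-similar sets that are the attractors of iterated function systems $\{F_1,\dots,F_A\}$ and $\{G_1,\dots,G_B\}$ of affine contractions of $\mathbb{R}$, and let $d_\lambda,d_\gamma$ be the similarity dimensions of $C_\lambda,C_\gamma$, respectively. Then $\mathcal{H}^{d_\gamma+d_\lambda}(C_\lambda+C_\gamma)=0$ if and only if for any $\epsilon>0$ there exist two distinct $\epsilon$-relatively close $\epsilon$-squares.
   Context: Setting: $F_i(x)=O^\lambda_i\lambda_i x+b_i$ ($1\le i\le A$) and $G_j(x)=O^\gamma_j\gamma_j x+c_j$ ($1\le j\le B$), where $O^\lambda_i,O^\gamma_j\in\{+1,-1\}$, $0<\lambda_i,\gamma_j<1$, $b_i,c_j\in\mathbb{R}$. $C_\lambda,C_\gamma$ are the attractors (the unique nonempty compact sets with $C_\lambda=\bigcup_i F_i(C_\lambda)$, $C_\gamma=\bigcup_j G_j(C_\gamma)$). The similarity dimensions are the real numbers $d_\lambda,d_\gamma$ with $\sum_{i=1}^A\lambda_i^{d_\lambda}=1$ and $\sum_{j=1}^B\gamma_j^{d_\gamma}=1$. $D=\max\{D_\lambda,D_\gamma\}$, where $D_\lambda,D_\gamma$ are the diameters of $C_\lambda,C_\gamma$. $\mathcal{H}^s$ is $s$-dimensional Hausdorff measure and $C_\lambda+C_\gamma=\{x+y: x\in C_\lambda, y\in C_\gamma\}$. Codings: $\Omega_\lambda=\{1,\dots,A\}^{\mathbb{N}}$, $\Omega_\gamma=\{1,\dots,B\}^{\mathbb{N}}$,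 $\Omega=\Omega_\lambda\times\Omega_\gamma$. $\Pi_\lambda(\omega)=\lim_{n\to\infty}F_{\omega_1}\circ\cdots\circ F_{\omega_n}(0)$ maps $\Omega_\lambda$ onto $C_\lambda$; $\Pi_\gamma$ is defined similarly with the $G_j$ and maps $\Omega_\gamma$ onto $C_\gamma$. $L(\omega,\tau)=\Pi_\lambda(\omega)+\Pi_\gamma(\tau)$ for $(\omega,\tau)\in\Omega$. Words: a word is a finite sequence of digits. For a word $u=u_1\cdots u_n$ in the digits $\{1,\dots,A\}$ put $\lambda_u=\lambda_{u_1}\cdots\lambda_{u_n}$ and $O^\lambda_u=O^\lambda_{u_1}\cdots O^\lambda_{u_n}$; for a word $v$ in the digits $\{1,\dots,B\}$, $\gamma_v$ and $O^\gamma_v$ are defined similarly. $u\bar 1$ is the infinite sequence consisting of $u$ followed by the digit $1$ repeated forever. A word of $\Omega$ is a pair $u\times v$ with $u$ a word in $\{1,\dots,A\}$ and $v$ a word in $\{1,\dots,B\}$; $u_1\times v_1$ and $u_2\times v_2$ are distinct if $(u_1,v_1)\ne(u_2,v_2)$. A word $u\times v$ of $\Omega$ is called a $\delta$-square if $\lambda_u/\gamma_v\in(e^{-\delta},e^{\delta})$. Words $u_1\times v_1$ and $u_2\times v_2$ of $\Omega$ are $\epsilon$-relatively close if: (i) $\lambda_{u_1}/\lambda_{u_2}\in(e^{-\epsilon},e^\epsilon)$ and $\gamma_{v_1}/\gamma_{v_2}\in(e^{-\epsilon},e^\epsilon)$; (ii) $O^\lambda_{u_1}=O^\lambda_{u_2}$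 and $O^\gamma_{v_1}=O^\gamma_{v_2}$; (iii) $|L(u_1\bar1,v_1\bar1)-L(u_2\bar1,v_2\bar1)|<\epsilon D\min\{\lambda_{u_1},\lambda_{u_2},\gamma_{v_1},\gamma_{v_2}\}$.
   Formalization: The case where both attractors are single points (D=0) and A≥2 or B≥2 is excluded: there the sumset is a point of measure 0 since d_γ+d_λ>0, but no words are ε-relatively close as (iii) reads |…|<0, so the claim is false (e.g. F=x/2, x/3; G=x/2). *)

theory Defs
  imports "HOL-Analysis.Analysis"
begin

text \<open>
  The \<open>s\<close>-th power of the diameter, for \<open>s \<ge> 0\<close>. The cases make the
  zero-dimensional measure the counting measure: \<open>0 powr 0 = 0\<close> in HOL, whereas here
  a nonempty set must contribute 1 when \<open>s = 0\<close> and the empty set must contribute 0.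
\<close>

definition diam_pow :: "real \<Rightarrow> 'a::metric_space set \<Rightarrow> ennreal" where
  "diam_pow s U =
     (if U = {} then 0 else if s = 0 then 1 else ennreal (diameter U powr s))"

text \<open>
  Boundedness is required explicitly because \<^const>\<open>diameter\<close> is meaningless on
  unbounded sets. Finite covers are included, since the \<open>U i\<close> may be empty.
\<close>

definition hausdorff_content :: "real \<Rightarrow> real \<Rightarrow> 'a::metric_space set \<Rightarrow> ennreal" where
  "hausdorff_content s \<delta> E =
     (INF U \<in> {U :: nat \<Rightarrow> 'a set. E \<subseteq> (\<Union>i. U i) \<and>
                 (\<forall>i. bounded (U i) \<and> diameter (U i) \<le> \<delta>)}. \<Sum>i. diam_pow s (U i))"

definition hausdorff_measure :: "real \<Rightarrow> 'a::metric_space set \<Rightarrow> ennreal" where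
  "hausdorff_measure s E = (SUP \<delta> \<in> {0<..}. hausdorff_content s \<delta> E)"

text \<open>
  An indexed family of maps \<open>x \<mapsto> orient i * ratio i * x + shift i\<close> for
  \<open>1 \<le> i \<le> nmaps\<close>; different indices may carry the same map. Field values at other
  indices are irrelevant.
\<close>

record ifs =
  nmaps :: nat
  orient :: "nat \<Rightarrow> real"
  ratio :: "nat \<Rightarrow> real"
  shift :: "nat \<Rightarrow> real"

definition ifs_map :: "ifs \<Rightarrow> nat \<Rightarrow> real \<Rightarrow> real" where
  "ifs_map S i x = orient S i * ratio S i * x + shift S i"

definition contractive_ifs :: "ifs \<Rightarrow> bool" where
  "contractive_ifs S \<longleftrightarrow> 1 \<le> nmaps S \<and>
     (\<forall>i \<in> {1..nmaps S}. orient S i \<in> {1, -1} \<and> 0 < ratio S i \<and> ratio S i < 1)"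

definition is_attractor :: "ifs \<Rightarrow> real set \<Rightarrow> bool" where
  "is_attractor S K \<longleftrightarrow>
     compact K \<and> K \<noteq> {} \<and> K = (\<Union>i \<in> {1..nmaps S}. ifs_map S i ` K)"

definition is_similarity_dim :: "ifs \<Rightarrow> real \<Rightarrow> bool" where
  "is_similarity_dim S d \<longleftrightarrow> (\<Sum>i = 1..nmaps S. ratio S i powr d) = 1"

text \<open>
  Words are lists of digits (the empty word included). Infinite sequences are functions on
  \<^typ>\<open>nat\<close>, so that \<open>\<omega> 0\<close> is the first digit.
\<close>

definition words :: "ifs \<Rightarrow> nat list set" where
  "words S = {u. set u \<subseteq> {1..nmaps S}}"

definition word_ratio :: "ifs \<Rightarrow> nat list \<Rightarrow> real" where
  "word_ratio S u = (\<Prod>i\<leftarrow>u. ratio S i)"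

definition word_orient :: "ifs \<Rightarrow> nat list \<Rightarrow> real" where
  "word_orient S u = (\<Prod>i\<leftarrow>u. orient S i)"

definition pad_ones :: "nat list \<Rightarrow> nat \<Rightarrow> nat" where
  "pad_ones u n = (if n < length u then u ! n else 1)"

definition coding_map :: "ifs \<Rightarrow> (nat \<Rightarrow> nat) \<Rightarrow> real" where
  "coding_map S \<omega> = lim (\<lambda>n. foldr (ifs_map S) (map \<omega> [0..<n]) 0)"

definition sum_coding :: "ifs \<Rightarrow> ifs \<Rightarrow> (nat \<Rightarrow> nat) \<times> (nat \<Rightarrow> nat) \<Rightarrow> real" where
  "sum_coding S T = (\<lambda>(\<omega>, \<tau>). coding_map S \<omega> + coding_map T \<tau>)"

definition is_square :: "ifs \<Rightarrow> ifs \<Rightarrow> real \<Rightarrow> nat list \<times> nat list \<Rightarrow> bool" where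
  "is_square S T \<delta> = (\<lambda>(u, v).
     word_ratio S u / word_ratio T v \<in> {exp (-\<delta>)<..<exp \<delta>})"

text \<open>
  The parameter \<open>D\<close> stands for the larger of the diameters of the two attractors.
\<close>

definition relatively_close ::
  "ifs \<Rightarrow> ifs \<Rightarrow> real \<Rightarrow> real \<Rightarrow> nat list \<times> nat list \<Rightarrow> nat list \<times> nat list \<Rightarrow> bool" where
  "relatively_close S T D \<epsilon> = (\<lambda>(u1, v1) (u2, v2).
     word_ratio S u1 / word_ratio S u2 \<in> {exp (-\<epsilon>)<..<exp \<epsilon>} \<and>
     word_ratio T v1 / word_ratio T v2 \<in> {exp (-\<epsilon>)<..<exp \<epsilon>} \<and>
     word_orient S u1 = word_orient S u2 \<and>
     word_orient T v1 = word_orient T v2 \<and>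
     \<bar>sum_coding S T (pad_ones u1, pad_ones v1) - sum_coding S T (pad_ones u2, pad_ones v2)\<bar>
       < \<epsilon> * D * Min {word_ratio S u1, word_ratio S u2, word_ratio T v1, word_ratio T v2})"

end

theory Submission
  imports Defs "HOL-Library.Sublist"
begin

text \<open>
  Write \<open>s\<close> for the sum of the two dimensions and let the mass of a pair of words \<open>(u, v)\<close> be
  \<open>\<lambda>\<^sub>u\<close> to the power \<open>d\<^sub>F\<close> times \<open>\<gamma>\<^sub>v\<close> to the power \<open>d\<^sub>G\<close>, that is, the product Bernoulli measure
  of its cylinder. If both ratios of a pair are comparable to \<open>\<rho>\<close>, its mass is comparable to
  \<open>\<rho>\<^sup>s\<close> and its image in the sumset has diameter at most a constant times \<open>\<rho>\<close>. So the measure of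
  the sumset is positive precisely when such images cannot pile up.

  A pair of bounded shape, that is, with \<open>\<lambda>\<^sub>u / \<gamma>\<^sub>v\<close> bounded away from \<open>0\<close> and \<open>\<infinity>\<close>, can be turned
  into a near-square of positive orientations by a suffix from a fixed finite set
  (\<open>finite_corrections\<close>); this rests on Dirichlet's approximation theorem.

  Suppose that for some \<open>\<epsilon>\<close> there are no two distinct relatively close squares. If many pairs
  of size \<open>\<rho>\<close> had base points in one interval of length comparable to \<open>\<rho>\<close>, then by the
  pigeonhole principle two of them would have almost the same ratios and base points and the
  same orientations, and a common correcting suffix would make them relatively close squares.
  Hence their number is bounded (\<open>bounded_multiplicity\<close>), and the mass distribution principle
  bounds the cost of every covering from below (\<open>cost_lower_bound\<close>).

  Conversely, from relatively close squares of every precision one builds, by prefixing ever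
  more precise pairs, families of \<open>2\<^sup>n\<close> disjoint cylinders of nearly equal size whose images lie
  in a common interval of comparable length (\<open>exists_crowd\<close>). Every pair of bounded shape contains a copy of such a family which carries
  a fixed proportion of its mass and is covered at \<open>2\<^sup>n\<close> times less than the expected cost
  (\<open>exists_efficient_part\<close>). Comparing with the best constant \<open>c\<close> such that all these pairs can
  be covered at cost \<open>c\<close> times their mass shows that this constant is at most of order
  \<open>2\<close> to the power \<open>-n\<close> for every \<open>n\<close> (\<open>coverable_arbitrarily_small\<close>), so the measure vanishes.

  If \<open>D = 0\<close>, both systems consist of a single map, the sumset is a point of counting measure 1,
  and no two words are relatively close.
\<close>

section \<open>Words and their similarities\<close>

lemma words_append_iff [simp]: "u @ v \<in> words S \<longleftrightarrow> u \<in> words S \<and> v \<in> words S"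
  by (auto simp: words_def)

lemma words_Nil [simp]: "[] \<in> words S"
  by (simp add: words_def)

lemma words_Cons_iff [simp]: "i # u \<in> words S \<longleftrightarrow> i \<in> {1..nmaps S} \<and> u \<in> words S"
  by (auto simp: words_def)

lemma word_ratio_Nil [simp]: "word_ratio S [] = 1"
  by (simp add: word_ratio_def)

lemma word_ratio_Cons [simp]: "word_ratio S (i # u) = ratio S i * word_ratio S u"
  by (simp add: word_ratio_def)

lemma word_ratio_append [simp]: "word_ratio S (u @ v) = word_ratio S u * word_ratio S v"
  by (simp add: word_ratio_def)

lemma word_orient_Nil [simp]: "word_orient S [] = 1"
  by (simp add: word_orient_def)

lemma word_orient_Cons [simp]: "word_orient S (i # u) = orient S i * word_orient S u"
  by (simp add: word_orient_def)

lemma word_orient_append [simp]: "word_orient S (u @ v) = word_orient S u * word_orient S v"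
  by (simp add: word_orient_def)

text \<open>The similarity \<open>f\<^sub>u = f\<^bsub>u\<^sub>1\<^esub> \<circ> \<dots> \<circ> f\<^bsub>u\<^sub>n\<^esub>\<close> attached to a word.\<close>

definition word_map :: "ifs \<Rightarrow> nat list \<Rightarrow> real \<Rightarrow> real" where
  "word_map S u = foldr (ifs_map S) u"

lemma word_map_Nil [simp]: "word_map S [] x = x"
  by (simp add: word_map_def)

lemma word_map_Cons: "word_map S (i # u) x = ifs_map S i (word_map S u x)"
  by (simp add: word_map_def)

lemma word_map_append: "word_map S (u @ v) x = word_map S u (word_map S v x)"
  by (simp add: word_map_def)

lemma isCont_affine: "isCont (\<lambda>x::real. a * (x - y) + b) z"
  by (intro continuous_intros)

lemma word_map_diff:
  "word_map S u x - word_map S u y = word_orient S u * word_ratio S u * (x - y)"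
proof (induction u)
  case (Cons i u)
  have "word_map S (i # u) x - word_map S (i # u) y
      = orient S i * ratio S i * (word_map S u x - word_map S u y)"
    by (simp add: word_map_Cons ifs_map_def algebra_simps)
  then show ?case
    using Cons by simp
qed simp

text \<open>
  The words extending \<open>u\<close> at which the contraction ratio first drops to \<open>\<rho>\<close> or below. For
  \<open>\<rho> < word_ratio S u\<close> their cylinders partition the cylinder of \<open>u\<close> into pieces of size
  comparable to \<open>\<rho>\<close>.
\<close>

definition stopped :: "ifs \<Rightarrow> real \<Rightarrow> nat list \<Rightarrow> nat list set" where
  "stopped S \<rho> u =
     {w \<in> words S. prefix u w \<and> word_ratio S w \<le> \<rho> \<and> \<rho> < word_ratio S (butlast w)}"

text \<open>
  A contracting system with an attractor \<open>K\<close> and similarity dimension \<open>d\<close>. The number \<open>mass u\<close>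
  is the measure of the cylinder of \<open>u\<close> under the Bernoulli measure whose digit \<open>i\<close> has
  probability \<open>ratio S i powr d\<close>, and \<open>base\<close> is the point coded by the constant sequence of ones.
\<close>

locale self_similar =
  fixes S :: ifs and K :: "real set" and d :: real
  assumes contractive: "contractive_ifs S"
    and attractor: "is_attractor S K"
    and sim_dim: "is_similarity_dim S d"
begin

definition mass :: "nat list \<Rightarrow> real" where
  "mass u = word_ratio S u powr d"

definition base :: real where
  "base = shift S 1 / (1 - orient S 1 * ratio S 1)"

definition rmin :: real where
  "rmin = Min (ratio S ` {1..nmaps S})"

definition rmax :: real where
  "rmax = Max (ratio S ` {1..nmaps S})"

lemma nmaps_pos: "1 \<le> nmaps S"
  using contractive by (simp add: contractive_ifs_def)

lemma digit:
  assumes "i \<in> {1..nmaps S}"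
  shows "0 < ratio S i" "ratio S i < 1" "orient S i = 1 \<or> orient S i = -1"
    "rmin \<le> ratio S i" "ratio S i \<le> rmax"
  using contractive assms by (auto simp: contractive_ifs_def rmin_def rmax_def)

lemma rmin_pos: "0 < rmin" and rmax_less_1: "rmax < 1" and rmin_less_1: "rmin < 1"
  and rmax_pos: "0 < rmax"
proof -
  have "ratio S ` {1..nmaps S} \<noteq> {}" "finite (ratio S ` {1..nmaps S})"
    using nmaps_pos by auto
  from Min_in[OF this(2,1)] Max_in[OF this(2,1)]
  show "0 < rmin" "rmax < 1" "rmin < 1" "0 < rmax"
    unfolding rmin_def rmax_def using digit(1,2) by (metis imageE)+
qed

lemma word_ratio_pos: "u \<in> words S \<Longrightarrow> 0 < word_ratio S u"
  by (induction u) (auto intro!: mult_pos_pos digit)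

lemma word_ratio_le_1: "u \<in> words S \<Longrightarrow> word_ratio S u \<le> 1"
proof (induction u)
  case (Cons i u)
  then show ?case
    using digit(1,2)[of i] word_ratio_pos[of u] by (auto intro!: mult_le_one)
qed simp

lemma word_orient_cases: "u \<in> words S \<Longrightarrow> word_orient S u = 1 \<or> word_orient S u = -1"
proof (induction u)
  case (Cons i u)
  then show ?case
    using digit(3)[of i] by auto
qed simp

lemma word_orient_abs [simp]: "u \<in> words S \<Longrightarrow> \<bar>word_orient S u\<bar> = 1"
  using word_orient_cases by force

lemma word_orient_square [simp]: "u \<in> words S \<Longrightarrow> word_orient S u * word_orient S u = 1"
  using word_orient_cases by force

lemma mass_pos: "u \<in> words S \<Longrightarrow> 0 < mass u"
  using word_ratio_pos[of u] by (simp add: mass_def)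

lemma mass_append: "u \<in> words S \<Longrightarrow> v \<in> words S \<Longrightarrow> mass (u @ v) = mass u * mass v"
  using word_ratio_pos[of u] word_ratio_pos[of v] by (simp add: mass_def powr_mult)

lemma mass_children:
  assumes "u \<in> words S"
  shows "(\<Sum>i = 1..nmaps S. mass (u @ [i])) = mass u"
proof -
  have "(\<Sum>i = 1..nmaps S. mass (u @ [i])) = (\<Sum>i = 1..nmaps S. mass u * ratio S i powr d)"
    using assms by (intro sum.cong) (simp_all only: mass_append words_Cons_iff words_Nil simp_thms, simp add: mass_def)
  also have "\<dots> = mass u"
    using sim_dim by (simp add: is_similarity_dim_def flip: sum_distrib_left)
  finally show ?thesis .
qed

lemma dim_nonneg: "0 \<le> d"
proof (rule ccontr)
  assume "\<not> 0 \<le> d"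
  have 1: "1 \<in> {1..nmaps S}"
    using nmaps_pos by simp
  have "1 < ratio S 1 powr d"
    using digit(1,2)[OF 1] \<open>\<not> 0 \<le> d\<close> by (simp add: powr_def mult_neg_neg)
  also have "\<dots> \<le> (\<Sum>i = 1..nmaps S. ratio S i powr d)"
    using 1 by (intro member_le_sum) auto
  finally show False
    using sim_dim by (simp add: is_similarity_dim_def)
qed

lemma nmaps_eq_1_imp_dim_eq_0:
  assumes "nmaps S = 1"
  shows "d = 0"
proof -
  have "ratio S 1 powr d = 1"
    using sim_dim assms by (simp add: is_similarity_dim_def)
  then show ?thesis
    using digit(1,2)[of 1] assms by (simp add: powr_def)
qed

lemma dim_eq_0_imp_nmaps_eq_1:
  assumes "d = 0"
  shows "nmaps S = 1"
proof -
  have "ratio S i powr d = 1" if "i \<in> {1..nmaps S}" for i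
    using digit(1)[OF that] assms by simp
  then show ?thesis
    using sim_dim by (simp add: is_similarity_dim_def)
qed

subsection \<open>The attractor\<close>

lemma compact_K: "compact K" and K_nonempty: "K \<noteq> {}"
  using attractor by (auto simp: is_attractor_def)

lemma K_eq: "K = (\<Union>i \<in> {1..nmaps S}. ifs_map S i ` K)"
  using attractor by (simp add: is_attractor_def)

lemma word_map_in_K: "u \<in> words S \<Longrightarrow> x \<in> K \<Longrightarrow> word_map S u x \<in> K"
proof (induction u)
  case (Cons i u)
  then have "word_map S u x \<in> K" "i \<in> {1..nmaps S}"
    by auto
  then have "word_map S (i # u) x \<in> (\<Union>i \<in> {1..nmaps S}. ifs_map S i ` K)"
    by (auto simp: word_map_Cons)
  then show ?case
    using K_eq by blast
qed simp

lemma base_fixed: "ifs_map S 1 base = base"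
proof -
  have "1 - orient S 1 * ratio S 1 \<noteq> 0"
    using digit(1-3)[of 1] nmaps_pos by auto
  then show ?thesis
    by (simp add: ifs_map_def base_def field_simps)
qed

lemma word_map_ones_tendsto: "(\<lambda>n. word_map S (replicate n 1) x) \<longlonglongrightarrow> base"
proof -
  have eq: "word_map S (replicate n 1) x
      = base + (orient S 1 * ratio S 1) ^ n * (x - base)" for n
  proof (induction n)
    case (Suc n)
    have "word_map S (replicate (Suc n) 1) x
        = ifs_map S 1 (base + (orient S 1 * ratio S 1) ^ n * (x - base))"
      using Suc by (simp add: word_map_Cons)
    also have "\<dots> = ifs_map S 1 base + (orient S 1 * ratio S 1) ^ Suc n * (x - base)"
      by (simp add: ifs_map_def algebra_simps)
    finally show ?case
      by (simp only: base_fixed)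
  qed simp
  have "\<bar>orient S 1 * ratio S 1\<bar> < 1"
    using digit(1-3)[of 1] nmaps_pos by auto
  then have "(\<lambda>n. (orient S 1 * ratio S 1) ^ n) \<longlonglongrightarrow> 0"
    by (intro LIMSEQ_power_zero) simp
  from tendsto_add[OF tendsto_const[of base] tendsto_mult_right[OF this, of "x - base"]]
  show ?thesis
    unfolding eq by simp
qed

lemma base_in_K: "base \<in> K"
proof -
  obtain x where "x \<in> K"
    using K_nonempty by blast
  moreover have "replicate n 1 \<in> words S" for n
    using nmaps_pos by (auto simp: words_def)
  ultimately have "word_map S (replicate n 1) x \<in> K" for n
    by (intro word_map_in_K)
  then show ?thesis
    by (intro closed_sequentially[OF compact_imp_closed[OF compact_K] _ word_map_ones_tendsto])
qed

lemma coding_map_pad_ones: "coding_map S (pad_ones u) = word_map S u base"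
proof -
  have eq: "map (pad_ones u) [0..<n + length u] = u @ replicate n 1" for n
    by (rule nth_equalityI) (auto simp: pad_ones_def nth_append)
  have cont: "isCont (word_map S u) y" for y
  proof -
    have "word_map S u = (\<lambda>x. word_orient S u * word_ratio S u * (x - y) + word_map S u y)"
      by (rule ext) (use word_map_diff[of S u _ y] in \<open>simp add: algebra_simps\<close>)
    then show ?thesis
      by (rule ssubst[where P = "\<lambda>f. isCont f y"]) (rule isCont_affine)
  qed
  have "(\<lambda>n. word_map S u (word_map S (replicate n 1) 0)) \<longlonglongrightarrow> word_map S u base"
    by (intro isCont_tendsto_compose[OF cont] word_map_ones_tendsto)
  then have "(\<lambda>n. foldr (ifs_map S) (map (pad_ones u) [0..<n + length u]) 0) \<longlonglongrightarrow> word_map S u base"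
    unfolding eq by (simp add: word_map_def)
  then have "(\<lambda>n. foldr (ifs_map S) (map (pad_ones u) [0..<n]) 0) \<longlonglongrightarrow> word_map S u base"
    by (rule LIMSEQ_offset)
  then show ?thesis
    unfolding coding_map_def by (rule limI)
qed

lemma nmaps_eq_1_imp_diameter_0:
  assumes "nmaps S = 1"
  shows "diameter K = 0"
proof -
  have *: "x = base" if "x \<in> K" for x
  proof -
    have eq: "K = ifs_map S 1 ` K"
      using K_eq assms by auto
    obtain y where y: "y \<in> K" "\<And>z. z \<in> K \<Longrightarrow> dist base z \<le> dist base y"
      using distance_attains_sup[OF compact_K K_nonempty] by blast
    obtain y' where y': "y' \<in> K" "y = ifs_map S 1 y'"
      using y(1) eq by auto
    have "dist base y = \<bar>ifs_map S 1 base - ifs_map S 1 y'\<bar>"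
      unfolding y'(2) dist_real_def by (simp only: base_fixed)
    also have "ifs_map S 1 base - ifs_map S 1 y' = orient S 1 * ratio S 1 * (base - y')"
      by (simp add: ifs_map_def algebra_simps)
    also have "\<bar>\<dots>\<bar> = ratio S 1 * dist base y'"
      using digit(1-3)[of 1] assms by (auto simp: abs_mult dist_real_def)
    also have "\<dots> \<le> ratio S 1 * dist base y"
      using digit(1)[of 1] assms y(2)[OF y'(1)] by (intro mult_left_mono) auto
    finally have "(1 - ratio S 1) * dist base y \<le> 0"
      by (simp add: algebra_simps)
    then have "dist base y \<le> 0"
      using digit(2)[of 1] assms by (simp add: mult_le_0_iff)
    then have "dist base x \<le> 0"
      using y(2)[OF that] by simp
    then show ?thesis
      by simp
  qed
  then have "K = {base}"
    using K_nonempty by blast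
  then show ?thesis
    by simp
qed

subsection \<open>Stopping words\<close>

lemma stopped_rec:
  assumes "u \<in> words S" "\<rho> < word_ratio S u"
  shows "stopped S \<rho> u = (\<Union>i \<in> {1..nmaps S}.
    if word_ratio S (u @ [i]) \<le> \<rho> then {u @ [i]} else stopped S \<rho> (u @ [i]))"
    (is "_ = (\<Union>i\<in>_. ?T i)")
proof (intro set_eqI iffI)
  fix w assume w: "w \<in> stopped S \<rho> u"
  then obtain t where "w = u @ t"
    by (auto simp: stopped_def prefix_def)
  moreover have "t \<noteq> []"
    using w assms calculation by (auto simp: stopped_def)
  ultimately obtain i t' where eq: "w = u @ i # t'"
    by (metis list.exhaust)
  have i: "i \<in> {1..nmaps S}" and t': "t' \<in> words S"
    using w by (auto simp: eq stopped_def)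
  have "w \<in> ?T i"
  proof (cases "word_ratio S (u @ [i]) \<le> \<rho>")
    case True
    have "t' = []"
    proof (rule ccontr)
      assume "t' \<noteq> []"
      then have "butlast w = (u @ [i]) @ butlast t'"
        by (simp add: eq butlast_append)
      moreover have "butlast t' \<in> words S"
        using t' by (auto simp: words_def dest: in_set_butlastD)
      ultimately have "word_ratio S (butlast w) \<le> word_ratio S (u @ [i])"
        using word_ratio_le_1[of "butlast t'"] word_ratio_pos[of "u @ [i]"] assms(1) i
        by (simp add: mult_left_le flip: mult.assoc)
      then show False
        using True w by (auto simp: stopped_def)
    qed
    then show ?thesis
      using True by (simp add: eq)
  next
    case False
    then show ?thesis
      using w by (auto simp: stopped_def eq)
  qed
  then show "w \<in> (\<Union>i \<in> {1..nmaps S}. ?T i)"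
    using i by blast
next
  fix w assume "w \<in> (\<Union>i \<in> {1..nmaps S}. ?T i)"
  then obtain i where "i \<in> {1..nmaps S}" "w \<in> ?T i"
    by blast
  then show "w \<in> stopped S \<rho> u"
    using assms by (auto simp: stopped_def prefix_def split: if_splits)
qed

lemma stopping_induct [consumes 3, case_names step]:
  assumes "0 < \<rho>" "u \<in> words S" "\<rho> < word_ratio S u"
    and step: "\<And>u. u \<in> words S \<Longrightarrow> \<rho> < word_ratio S u \<Longrightarrow>
      (\<And>i. i \<in> {1..nmaps S} \<Longrightarrow> \<rho> < word_ratio S (u @ [i]) \<Longrightarrow> P (u @ [i])) \<Longrightarrow> P u"
  shows "P u"
proof -
  have "P u" if "u \<in> words S" "\<rho> < word_ratio S u" "word_ratio S u * rmax ^ n \<le> \<rho>" for n u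
    using that
  proof (induction n arbitrary: u)
    case (Suc n)
    show ?case
    proof (rule step)
      fix i assume i: "i \<in> {1..nmaps S}" "\<rho> < word_ratio S (u @ [i])"
      have "word_ratio S (u @ [i]) * rmax ^ n \<le> word_ratio S u * rmax * rmax ^ n"
        using digit(1,5)[OF i(1)] word_ratio_pos[OF Suc.prems(1)] rmax_pos
        by (intro mult_right_mono) (auto intro!: mult_left_mono)
      then show "P (u @ [i])"
        using Suc i by (intro Suc.IH) (auto simp: mult.assoc)
    qed (use Suc in auto)
  qed auto
  moreover obtain n where "rmax ^ n < \<rho>"
    using real_arch_pow_inv[OF assms(1) rmax_less_1] by blast
  moreover have "word_ratio S u * rmax ^ n \<le> rmax ^ n"
    using word_ratio_le_1[OF assms(2)] rmax_pos by simp
  ultimately show ?thesis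
    using assms(2,3) by (meson less_imp_le order_trans)
qed

lemma finite_stopped:
  assumes "0 < \<rho>" "u \<in> words S" "\<rho> < word_ratio S u"
  shows "finite (stopped S \<rho> u)"
  using assms
proof (induction rule: stopping_induct)
  case (step u)
  then show ?case
    by (auto simp: stopped_rec[OF step(1,2)] simp del: word_ratio_append)
qed

lemma sum_mass_stopped:
  assumes "0 < \<rho>" "u \<in> words S" "\<rho> < word_ratio S u"
  shows "(\<Sum>w \<in> stopped S \<rho> u. mass w) = mass u"
  using assms
proof (induction rule: stopping_induct)
  case (step u)
  let ?T = "\<lambda>i. if word_ratio S (u @ [i]) \<le> \<rho> then {u @ [i]} else stopped S \<rho> (u @ [i])"
  have pre: "prefix (u @ [i]) w" if "w \<in> ?T i" for i w
    using that by (auto simp: stopped_def split: if_splits)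
  have "(\<Sum>w \<in> stopped S \<rho> u. mass w) = (\<Sum>i = 1..nmaps S. \<Sum>w \<in> ?T i. mass w)"
    unfolding stopped_rec[OF step(1,2)]
  proof (rule sum.UNION_disjoint)
    show "\<forall>i\<in>{1..nmaps S}. finite (?T i)"
      using finite_stopped[OF assms(1)] step by auto
    show "\<forall>i\<in>{1..nmaps S}. \<forall>j\<in>{1..nmaps S}. i \<noteq> j \<longrightarrow> ?T i \<inter> ?T j = {}"
    proof (intro ballI impI, rule ccontr)
      fix i j assume "i \<noteq> j" "?T i \<inter> ?T j \<noteq> {}"
      then obtain w where "w \<in> ?T i" "w \<in> ?T j"
        by blast
      then have "prefix (u @ [i]) w" "prefix (u @ [j]) w"
        using pre by blast+
      then show False
        using \<open>i \<noteq> j\<close> by (auto simp: prefix_def)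
    qed
  qed simp
  also have "\<dots> = (\<Sum>i = 1..nmaps S. mass (u @ [i]))"
    using step by (intro sum.cong) auto
  also have "\<dots> = mass u"
    by (rule mass_children) fact
  finally show ?case .
qed

lemma image_stopped:
  assumes "0 < \<rho>" "u \<in> words S" "\<rho> < word_ratio S u"
  shows "word_map S u ` K = (\<Union>w \<in> stopped S \<rho> u. word_map S w ` K)"
  using assms
proof (induction rule: stopping_induct)
  case (step u)
  have "word_map S u ` K = word_map S u ` (\<Union>i \<in> {1..nmaps S}. ifs_map S i ` K)"
    using K_eq by simp
  also have "\<dots> = (\<Union>i \<in> {1..nmaps S}. word_map S (u @ [i]) ` K)"
    by (auto simp: word_map_append word_map_Cons image_UN image_image)
  also have "\<dots> = (\<Union>i \<in> {1..nmaps S}. \<Union>w \<in> (if word_ratio S (u @ [i]) \<le> \<rho> then {u @ [i]}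
      else stopped S \<rho> (u @ [i])). word_map S w ` K)"
    using step(3) by (intro SUP_cong refl) (auto simp: not_le simp del: word_ratio_append)
  also have "\<dots> = (\<Union>w \<in> stopped S \<rho> u. word_map S w ` K)"
    unfolding stopped_rec[OF step(1,2)] by blast
  finally show ?case .
qed

lemma stopped_bounds:
  assumes "w \<in> stopped S \<rho> u" "0 < \<rho>" "\<rho> < 1"
  shows "w \<in> words S" "prefix u w" "word_ratio S w \<le> \<rho>" "rmin * \<rho> < word_ratio S w"
proof -
  show *: "w \<in> words S" "prefix u w" "word_ratio S w \<le> \<rho>"
    using assms by (auto simp: stopped_def)
  have "w \<noteq> []"
    using *(3) assms(3) by auto
  then have eq: "w = butlast w @ [last w]"
    by simp
  then have "butlast w @ [last w] \<in> words S"
    using *(1) by simp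
  then have i: "last w \<in> {1..nmaps S}"
    by simp
  have "rmin * \<rho> < ratio S (last w) * word_ratio S (butlast w)"
    using digit[OF i] rmin_pos assms by (intro mult_le_less_imp_less) (auto simp: stopped_def)
  also have "\<dots> = word_ratio S (butlast w @ [last w])"
    by simp
  finally show "rmin * \<rho> < word_ratio S w"
    using eq by simp
qed

lemma exists_stopped_prefix:
  assumes "w \<in> words S" "prefix u w" "word_ratio S w \<le> \<rho>" "\<rho> < word_ratio S u"
  shows "\<exists>x \<in> stopped S \<rho> u. prefix x w"
  using assms
proof (induction w rule: rev_induct)
  case (snoc i w)
  show ?case
  proof (cases "word_ratio S w \<le> \<rho>")
    case True
    then have "prefix u w"
      using snoc.prems by auto
    then show ?thesis
      using snoc True by (auto intro: prefix_order.trans)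
  next
    case False
    then have "w @ [i] \<in> stopped S \<rho> u"
      using snoc.prems by (auto simp: stopped_def)
    then show ?thesis
      by blast
  qed
qed auto

lemma prefix_imp_eq:
  assumes "prefix x w" "w \<in> words S" "rmax * word_ratio S x < word_ratio S w"
  shows "x = w"
proof (rule ccontr)
  assume "x \<noteq> w"
  then obtain i t where eq: "w = x @ i # t"
    using assms(1) by (metis list.exhaust prefix_def append_Nil2)
  then have *: "i \<in> {1..nmaps S}" "t \<in> words S" "x \<in> words S"
    using assms(2) by auto
  have "word_ratio S w = word_ratio S x * (ratio S i * word_ratio S t)"
    by (simp add: eq)
  also have "\<dots> \<le> word_ratio S x * (rmax * 1)"
    using digit[OF *(1)] word_ratio_pos * word_ratio_le_1[OF *(2)]
    by (intro mult_left_mono mult_mono) (auto simp: less_imp_le)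
  finally show False
    using assms(3) by (simp add: mult.commute)
qed

end

section \<open>Comparing real numbers on a logarithmic scale\<close>

lemma ratio_near_iff:
  assumes "(0::real) < a" "0 < b"
  shows "a / b \<in> {exp (- t)<..<exp t} \<longleftrightarrow> \<bar>ln a - ln b\<bar> < t"
proof -
  have "a / b = exp (ln a - ln b)"
    using assms by (simp add: exp_diff)
  then show ?thesis
    by auto
qed

lemma diff_le_of_ln_diff:
  assumes "(0::real) < a" "0 < b" "\<bar>ln a - ln b\<bar> \<le> t" "t \<le> 1"
  shows "\<bar>a - b\<bar> \<le> 2 * t * b"
proof -
  have t: "0 \<le> t"
    using assms by linarith
  have a: "a = b * exp (ln a - ln b)"
    using assms by (simp add: exp_diff)
  have "exp (ln a - ln b) \<le> exp t"
    using assms by simp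
  also have "\<dots> \<le> 1 + t + t\<^sup>2"
    using t assms by (intro exp_bound) auto
  also have "\<dots> \<le> 1 + 2 * t"
    using t assms by (simp add: power2_eq_square mult_left_le)
  finally have 1: "exp (ln a - ln b) - 1 \<le> 2 * t"
    by simp
  have "1 + (ln a - ln b) \<le> exp (ln a - ln b)"
    by (rule exp_ge_add_one_self)
  then have 2: "- (2 * t) \<le> exp (ln a - ln b) - 1"
    using assms t by linarith
  have "a - b = b * (exp (ln a - ln b) - 1)"
    using a by (simp add: algebra_simps)
  then have "\<bar>a - b\<bar> = b * \<bar>exp (ln a - ln b) - 1\<bar>"
    using assms by (simp add: abs_mult)
  also have "\<dots> \<le> b * (2 * t)"
    using 1 2 assms by (intro mult_left_mono) auto
  finally show ?thesis
    by (simp add: mult_ac)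
qed

lemma le_3_mult_of_ln_diff:
  assumes "(0::real) < a" "0 < b" "\<bar>ln a - ln b\<bar> \<le> 1"
  shows "a \<le> 3 * b"
  using diff_le_of_ln_diff[OF assms] by linarith

lemma floor_div_eq_imp_near:
  fixes x y t :: real
  assumes "\<lfloor>x / t\<rfloor> = \<lfloor>y / t\<rfloor>" "0 < t"
  shows "\<bar>x - y\<bar> < t"
proof -
  have "\<bar>x / t - y / t\<bar> < 1"
    using assms(1) by linarith
  then have "\<bar>x - y\<bar> / t < 1"
    using assms(2) by (simp add: abs_divide flip: diff_divide_distrib)
  then show ?thesis
    using assms(2) by simp
qed

lemma floor_div_mem:
  fixes x t :: real
  assumes "a \<le> x" "x \<le> b" "0 < t"
  shows "\<lfloor>x / t\<rfloor> \<in> {\<lfloor>a / t\<rfloor>..\<lfloor>b / t\<rfloor>}"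
  using assms by (simp add: floor_mono divide_right_mono)

lemma finite_positive_lower_bound:
  fixes g :: "'a \<Rightarrow> real"
  assumes "finite W" "\<And>w. w \<in> W \<Longrightarrow> 0 < g w"
  obtains c where "0 < c" "c \<le> 1" "\<And>w. w \<in> W \<Longrightarrow> c \<le> g w"
proof
  let ?c = "Min (insert 1 (g ` W))"
  have "?c \<in> insert 1 (g ` W)"
    using assms by (intro Min_in) auto
  then show "0 < ?c"
    using assms by auto
  show "?c \<le> 1" "\<And>w. w \<in> W \<Longrightarrow> ?c \<le> g w"
    using assms by (auto intro: Min_le)
qed

section \<open>Pairs of words\<close>

text \<open>Coordinatewise concatenation.\<close>

definition cat :: "nat list \<times> nat list \<Rightarrow> nat list \<times> nat list \<Rightarrow> nat list \<times> nat list" where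
  "cat p q = (fst p @ fst q, snd p @ snd q)"

lemma fst_cat [simp]: "fst (cat p q) = fst p @ fst q" and snd_cat [simp]: "snd (cat p q) = snd p @ snd q"
  by (simp_all add: cat_def)

text \<open>Two pairs overlap iff the corresponding product cylinders of infinite sequences meet.\<close>

definition overlap :: "nat list \<times> nat list \<Rightarrow> nat list \<times> nat list \<Rightarrow> bool" where
  "overlap p q \<longleftrightarrow> (prefix (fst p) (fst q) \<or> prefix (fst q) (fst p)) \<and>
     (prefix (snd p) (snd q) \<or> prefix (snd q) (snd p))"

lemma overlap_sym: "overlap p q \<longleftrightarrow> overlap q p"
  by (auto simp: overlap_def)

lemma overlap_refl [simp]: "overlap p p"
  by (auto simp: overlap_def)

lemma overlap_cat_left [simp]: "overlap (cat p q) (cat p r) \<longleftrightarrow> overlap q r"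
  by (auto simp: overlap_def)

lemma prefix_append_comparable:
  assumes "prefix (u @ a) (v @ b)"
  shows "prefix u v \<or> prefix v u"
proof -
  have "prefix u (v @ b)"
    using assms append_prefixD by blast
  then show ?thesis
    using prefix_same_cases[of u "v @ b" v] by auto
qed

lemma overlap_cat_imp: "overlap (cat p a) (cat q b) \<Longrightarrow> overlap p q"
  unfolding overlap_def fst_cat snd_cat using prefix_append_comparable by blast

lemma overlap_of_common_extension:
  "prefix (fst p) u \<Longrightarrow> prefix (fst q) u \<Longrightarrow> prefix (snd p) v \<Longrightarrow> prefix (snd q) v \<Longrightarrow> overlap p q"
  unfolding overlap_def using prefix_same_cases by blast

text \<open>
  Two systems together with a common bound \<open>R\<close> for their attractors. For a pair \<open>p = (u, v)\<close> of
  words, \<open>lam p\<close> and \<open>gam p\<close> are the contraction ratios of \<open>u\<close> and \<open>v\<close>, \<open>val p x y\<close> is \<open>f\<^sub>u(x) + g\<^sub>v(y)\<close>, the set \<open>img p\<close> consists of all these sums with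
  \<open>x\<close>, \<open>y\<close> in the attractors, \<open>base p\<close> is the point coded by \<open>u\<close> and \<open>v\<close> padded with ones,
  \<open>mass p\<close> is the product measure of the cylinder, \<open>defect p\<close> measures on a logarithmic scale how
  far \<open>p\<close> is from being a square, and \<open>positive p\<close> says that neither word reverses orientation.
\<close>

locale ifs_pair = A: self_similar F K d + B: self_similar G M d'
  for F K d G M d' +
  fixes R :: real
  assumes R_pos: "0 < R"
    and K_bound: "x \<in> K \<Longrightarrow> \<bar>x\<bar> \<le> R"
    and M_bound: "y \<in> M \<Longrightarrow> \<bar>y\<bar> \<le> R"
begin

abbreviation pwords where "pwords \<equiv> words F \<times> words G"

abbreviation lam where "lam p \<equiv> word_ratio F (fst p)"

abbreviation gam where "gam p \<equiv> word_ratio G (snd p)"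

definition val :: "nat list \<times> nat list \<Rightarrow> real \<Rightarrow> real \<Rightarrow> real" where
  "val p x y = word_map F (fst p) x + word_map G (snd p) y"

definition base :: "nat list \<times> nat list \<Rightarrow> real" where
  "base p = val p A.base B.base"

definition img :: "nat list \<times> nat list \<Rightarrow> real set" where
  "img p = {val p x y | x y. x \<in> K \<and> y \<in> M}"

definition mass :: "nat list \<times> nat list \<Rightarrow> real" where
  "mass p = A.mass (fst p) * B.mass (snd p)"

definition defect :: "nat list \<times> nat list \<Rightarrow> real" where
  "defect p = ln (lam p) - ln (gam p)"

definition positive :: "nat list \<times> nat list \<Rightarrow> bool" where
  "positive p \<longleftrightarrow> word_orient F (fst p) = 1 \<and> word_orient G (snd p) = 1"

definition rmin :: real where
  "rmin = min A.rmin B.rmin"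

text \<open>
  The pairs of bounded shape, on which the covering of \<open>img p\<close> by a single ball is efficient up
  to a constant. The bound \<open>- ln rmin\<close> is the one satisfied by all pairs obtained by stopping both
  words at the same size.
\<close>

definition squarish :: "nat list \<times> nat list \<Rightarrow> bool" where
  "squarish p \<longleftrightarrow> p \<in> pwords \<and> \<bar>defect p\<bar> \<le> - ln rmin"

lemma lam_pos: "p \<in> pwords \<Longrightarrow> 0 < lam p" and gam_pos: "p \<in> pwords \<Longrightarrow> 0 < gam p"
  by (auto intro: A.word_ratio_pos B.word_ratio_pos)

lemma cat_in_pwords [simp]: "cat p q \<in> pwords \<longleftrightarrow> p \<in> pwords \<and> q \<in> pwords"
  by (auto simp: cat_def mem_Times_iff)

lemma ln_lam_cat: "p \<in> pwords \<Longrightarrow> q \<in> pwords \<Longrightarrow> ln (lam (cat p q)) = ln (lam p) + ln (lam q)"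
  using lam_pos[of p] lam_pos[of q] by (simp add: ln_mult)

lemma ln_gam_cat: "p \<in> pwords \<Longrightarrow> q \<in> pwords \<Longrightarrow> ln (gam (cat p q)) = ln (gam p) + ln (gam q)"
  using gam_pos[of p] gam_pos[of q] by (simp add: ln_mult)

lemma defect_cat: "p \<in> pwords \<Longrightarrow> q \<in> pwords \<Longrightarrow> defect (cat p q) = defect p + defect q"
  by (simp add: defect_def ln_lam_cat ln_gam_cat del: fst_cat snd_cat)

lemma mass_pos: "p \<in> pwords \<Longrightarrow> 0 < mass p"
  by (auto simp: mass_def intro!: mult_pos_pos A.mass_pos B.mass_pos)

lemma mass_cat: "p \<in> pwords \<Longrightarrow> q \<in> pwords \<Longrightarrow> mass (cat p q) = mass p * mass q"
  by (auto simp: mass_def A.mass_append B.mass_append)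

lemma val_cat: "val (cat p q) x y = val p (word_map F (fst q) x) (word_map G (snd q) y)"
  by (simp add: val_def word_map_append)

lemma base_cat: "base (cat p q) = val p (word_map F (fst q) A.base) (word_map G (snd q) B.base)"
  by (simp add: base_def val_cat)

lemma base_in_img: "base p \<in> img p"
  unfolding base_def img_def using A.base_in_K B.base_in_K by blast

lemma img_cat_subset: "q \<in> pwords \<Longrightarrow> img (cat p q) \<subseteq> img p"
  unfolding img_def val_cat using A.word_map_in_K[of "fst q"] B.word_map_in_K[of "snd q"]
  by (auto simp: mem_Times_iff)

lemma rmin_bounds: "0 < rmin" "rmin < 1" "rmin \<le> A.rmin" "rmin \<le> B.rmin"
  using A.rmin_pos A.rmin_less_1 B.rmin_pos by (auto simp: rmin_def)

lemma K_diff: "x \<in> K \<Longrightarrow> x' \<in> K \<Longrightarrow> \<bar>x - x'\<bar> \<le> 2 * R"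
  using K_bound[of x] K_bound[of x'] by linarith

lemma M_diff: "x \<in> M \<Longrightarrow> x' \<in> M \<Longrightarrow> \<bar>x - x'\<bar> \<le> 2 * R"
  using M_bound[of x] M_bound[of x'] by linarith

lemma val_diff_le:
  assumes "p \<in> pwords" "x \<in> K" "x' \<in> K" "y \<in> M" "y' \<in> M"
  shows "\<bar>val p x y - val p x' y'\<bar> \<le> 2 * R * (lam p + gam p)"
proof -
  have "val p x y - val p x' y' = (word_map F (fst p) x - word_map F (fst p) x')
      + (word_map G (snd p) y - word_map G (snd p) y')"
    by (simp add: val_def)
  also have "\<bar>\<dots>\<bar> \<le> \<bar>word_map F (fst p) x - word_map F (fst p) x'\<bar>
      + \<bar>word_map G (snd p) y - word_map G (snd p) y'\<bar>"
    by (rule abs_triangle_ineq)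
  also have "\<dots> = lam p * \<bar>x - x'\<bar> + gam p * \<bar>y - y'\<bar>"
    using assms(1) lam_pos[of p] gam_pos[of p] by (auto simp: word_map_diff abs_mult mem_Times_iff)
  also have "\<dots> \<le> lam p * (2 * R) + gam p * (2 * R)"
    using assms K_diff M_diff lam_pos[of p] gam_pos[of p]
    by (intro add_mono mult_left_mono) auto
  finally show ?thesis
    by (simp add: algebra_simps)
qed

lemma img_subset_cball:
  assumes "p \<in> pwords"
  shows "img p \<subseteq> cball (base p) (2 * R * (lam p + gam p))"
  unfolding img_def base_def
  using val_diff_le[OF assms A.base_in_K _ B.base_in_K] by (auto simp: dist_real_def)

text \<open>
  Replacing the common suffix of two pairs with equal orientations and nearly equal ratios
  hardly changes the distance between their values.
\<close>

lemma val_common_suffix: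
  assumes "p \<in> pwords" "q \<in> pwords" "x \<in> K" "y \<in> M"
    and "word_orient F (fst p) = word_orient F (fst q)" "word_orient G (snd p) = word_orient G (snd q)"
    and "\<bar>lam p - lam q\<bar> \<le> \<kappa>" "\<bar>gam p - gam q\<bar> \<le> \<kappa>"
  shows "\<bar>val p x y - val q x y\<bar> \<le> \<bar>base p - base q\<bar> + 4 * R * \<kappa>"
proof -
  have "val p x y - val q x y - (base p - base q)
    = (word_map F (fst p) x - word_map F (fst p) A.base) - (word_map F (fst q) x - word_map F (fst q) A.base)
    + ((word_map G (snd p) y - word_map G (snd p) B.base) - (word_map G (snd q) y - word_map G (snd q) B.base))"
    by (simp add: val_def base_def)
  also have "\<dots> = word_orient F (fst q) * (lam p - lam q) * (x - A.base)
    + word_orient G (snd q) * (gam p - gam q) * (y - B.base)"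
    unfolding word_map_diff assms(5,6) by (simp add: algebra_simps)
  also have "\<bar>\<dots>\<bar> \<le> \<bar>word_orient F (fst q) * (lam p - lam q) * (x - A.base)\<bar>
    + \<bar>word_orient G (snd q) * (gam p - gam q) * (y - B.base)\<bar>"
    by (rule abs_triangle_ineq)
  also have "\<dots> = \<bar>lam p - lam q\<bar> * \<bar>x - A.base\<bar> + \<bar>gam p - gam q\<bar> * \<bar>y - B.base\<bar>"
    using assms(2) by (auto simp: abs_mult mem_Times_iff)
  also have "\<dots> \<le> \<kappa> * (2 * R) + \<kappa> * (2 * R)"
    using assms K_diff A.base_in_K M_diff B.base_in_K by (intro add_mono mult_mono) auto
  also have "\<dots> = 4 * R * \<kappa>"
    by simp
  finally show ?thesis
    by linarith
qed

text \<open>A positively oriented near-square acts on \<open>x + y\<close> almost like a similarity.\<close>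

lemma val_near_square:
  assumes "positive p" "x \<in> K" "y \<in> M" "\<bar>gam p - lam p\<bar> \<le> \<kappa>"
  shows "\<bar>val p x y - base p - lam p * ((x + y) - (A.base + B.base))\<bar> \<le> 2 * R * \<kappa>"
proof -
  have "val p x y - base p = lam p * (x - A.base) + gam p * (y - B.base)"
    using assms(1) word_map_diff[of F "fst p" x A.base] word_map_diff[of G "snd p" y B.base]
    by (simp add: val_def base_def positive_def)
  then have "val p x y - base p - lam p * ((x + y) - (A.base + B.base))
      = (gam p - lam p) * (y - B.base)"
    by (simp add: algebra_simps)
  also have "\<bar>\<dots>\<bar> = \<bar>gam p - lam p\<bar> * \<bar>y - B.base\<bar>"
    by (simp add: abs_mult)
  also have "\<dots> \<le> \<kappa> * (2 * R)"
    using assms M_diff B.base_in_K by (intro mult_mono) auto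
  finally show ?thesis
    by (simp add: mult_ac)
qed

subsection \<open>Correcting the shape of a pair\<close>

text \<open>The \<open>n\<close>-fold repetition of a word.\<close>

definition word_power :: "nat \<Rightarrow> nat list \<Rightarrow> nat list" where
  "word_power n u = concat (replicate n u)"

lemma word_power_simps:
  "word_ratio S (word_power n u) = word_ratio S u ^ n"
  "word_orient S (word_power n u) = word_orient S u ^ n"
  "u \<in> words S \<Longrightarrow> word_power n u \<in> words S"
  "word_power (Suc n) u = u @ word_power n u"
  by (induction n) (auto simp: word_power_def)

lemma exists_multiple_near_multiple:
  fixes x a :: real
  assumes "0 \<le> x" "0 < a" "0 < \<epsilon>"
  obtains k l :: nat where "0 < k" "\<bar>real k * x - real l * a\<bar> < \<epsilon>"
proof -
  obtain N :: nat where N: "0 < N" "a / \<epsilon> < real N"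
    using reals_Archimedean2[of "max 0 (a / \<epsilon>)"] by auto
  obtain h k :: int where hk: "0 < k" "\<bar>of_int k * (x / a) - of_int h\<bar> < 1 / real N"
    using Dirichlet_approx[OF N(1)] by metis
  have "1 / real N \<le> 1"
    using N by simp
  moreover have "0 \<le> of_int k * (x / a)"
    using hk assms by simp
  ultimately have "-1 < (of_int h :: real)"
    using hk by linarith
  \<comment> \<open>The approximating integer is a multiplicity, so its sign matters.\<close>
  then have h: "0 \<le> h"
    by linarith
  have "\<bar>of_int k * x - of_int h * a\<bar> = a * \<bar>of_int k * (x / a) - of_int h\<bar>"
    using assms by (simp add: abs_mult_pos field_simps flip: abs_mult_pos)
  also have "\<dots> < a * (1 / real N)"
    using assms hk by (intro mult_strict_left_mono) auto
  also have "\<dots> < \<epsilon>"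
    using N assms by (simp add: field_simps)
  finally have "\<bar>real (nat k) * x - real (nat h) * a\<bar> < \<epsilon>"
    using h hk by simp
  then show thesis
    using hk that[of "nat k" "nat h"] by simp
qed

text \<open>
  Every pair extends to a positively oriented near-square: by Dirichlet's approximation
  theorem an even power of the pair followed by an even power of a single letter returns to
  defect almost zero.
\<close>

lemma exists_correction:
  assumes "p \<in> pwords" "0 < \<epsilon>"
  shows "\<exists>w \<in> pwords. \<bar>defect (cat p w)\<bar> < \<epsilon> \<and> positive (cat p w)"
proof -
  have one: "[1] \<in> words F" "[1] \<in> words G"
    using A.nmaps_pos B.nmaps_pos by auto
  define pw where "pw k l m = (word_power k (fst p) @ word_power l [1],
    word_power k (snd p) @ word_power m [1])" for k l m :: nat
  have in_pwords: "pw k l m \<in> pwords" for k l m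
    using assms(1) one
    by (auto simp: pw_def word_power_simps(3) mem_Times_iff simp del: words_Cons_iff)
  have defect_pw: "defect (pw k l m)
      = real k * defect p + real l * ln (ratio F 1) - real m * ln (ratio G 1)" for k l m
    using lam_pos[OF assms(1)] gam_pos[OF assms(1)] A.digit(1)[of 1] B.digit(1)[of 1]
      A.nmaps_pos B.nmaps_pos
    by (simp add: defect_def pw_def word_power_simps ln_mult ln_realpow algebra_simps)
  have positive_pw: "positive (pw (2 * k) (2 * l) (2 * m))" for k l m
  proof -
    have "word_orient F u ^ 2 = 1" if "u \<in> words F" for u
      using that by (simp add: power2_eq_square)
    moreover have "word_orient G u ^ 2 = 1" if "u \<in> words G" for u
      using that by (simp add: power2_eq_square)
    ultimately show ?thesis
      using assms(1) one
      by (simp add: positive_def pw_def word_power_simps power_mult mem_Times_iff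
          del: word_orient_Cons)
  qed
  have "\<exists>k l m. 0 < k \<and> \<bar>real k * defect p + real l * ln (ratio F 1) - real m * ln (ratio G 1)\<bar> < \<epsilon> / 2"
  proof (cases "0 \<le> defect p")
    case True
    obtain k l where "0 < k" "\<bar>real k * defect p - real l * (- ln (ratio F 1))\<bar> < \<epsilon> / 2"
      using exists_multiple_near_multiple[OF True, of "- ln (ratio F 1)" "\<epsilon> / 2"]
        A.digit(1,2)[of 1] A.nmaps_pos assms(2) by auto
    then have "0 < k \<and> \<bar>real k * defect p + real l * ln (ratio F 1) - real 0 * ln (ratio G 1)\<bar> < \<epsilon> / 2"
      by simp
    then show ?thesis
      by blast
  next
    case False
    obtain k m where "0 < k" "\<bar>real k * (- defect p) - real m * (- ln (ratio G 1))\<bar> < \<epsilon> / 2"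
      using exists_multiple_near_multiple[of "- defect p" "- ln (ratio G 1)" "\<epsilon> / 2"]
        B.digit(1,2)[of 1] B.nmaps_pos assms(2) False by auto
    then have "0 < k \<and> \<bar>real k * defect p + real 0 * ln (ratio F 1) - real m * ln (ratio G 1)\<bar> < \<epsilon> / 2"
      using abs_minus_cancel[of "real k * (- defect p) - real m * (- ln (ratio G 1))"]
      by (simp del: abs_minus_cancel)
    then show ?thesis
      by blast
  qed
  then obtain k l m where k: "0 < k"
    and less: "\<bar>real k * defect p + real l * ln (ratio F 1) - real m * ln (ratio G 1)\<bar> < \<epsilon> / 2"
    by blast
  \<comment> \<open>Doubling all exponents makes the orientations positive; one copy of \<open>p\<close> is the given pair.\<close>
  obtain j where j: "2 * k = Suc j"
    using k by (cases "2 * k") auto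
  have eq: "cat p (pw j (2 * l) (2 * m)) = pw (2 * k) (2 * l) (2 * m)"
    by (simp add: j cat_def pw_def word_power_simps(4))
  have "defect (pw (2 * k) (2 * l) (2 * m))
      = 2 * (real k * defect p + real l * ln (ratio F 1) - real m * ln (ratio G 1))"
    by (simp add: defect_pw algebra_simps)
  then have "\<bar>defect (pw (2 * k) (2 * l) (2 * m))\<bar> < \<epsilon>"
    using less by (simp only: abs_mult abs_numeral less_divide_eq_numeral1 mult.commute)
  then show ?thesis
    using positive_pw in_pwords by (intro bexI[of _ "pw j (2 * l) (2 * m)"]) (simp_all add: eq)
qed

text \<open>
  A finite set of corrections serves all pairs of bounded defect, because the correction of a
  pair also works for every pair of the same orientations and almost the same defect.
\<close>

lemma finite_corrections:
  assumes "0 < \<epsilon>"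
  shows "\<exists>W. finite W \<and> W \<subseteq> pwords \<and>
    (\<forall>p \<in> pwords. \<bar>defect p\<bar> \<le> b \<longrightarrow> (\<exists>w \<in> W. \<bar>defect (cat p w)\<bar> < \<epsilon> \<and> positive (cat p w)))"
proof -
  define X where "X = {p \<in> pwords. \<bar>defect p\<bar> \<le> b}"
  define cls where "cls p = (\<lfloor>defect p / (\<epsilon> / 2)\<rfloor>, word_orient F (fst p), word_orient G (snd p))" for p
  have "cls ` X \<subseteq> {\<lfloor>- b / (\<epsilon> / 2)\<rfloor>..\<lfloor>b / (\<epsilon> / 2)\<rfloor>} \<times> {1, -1} \<times> {1, -1}"
  proof (rule image_subsetI)
    fix p assume "p \<in> X"
    then have "- b \<le> defect p" "defect p \<le> b"
      unfolding X_def by auto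
    then have "\<lfloor>defect p / (\<epsilon> / 2)\<rfloor> \<in> {\<lfloor>- b / (\<epsilon> / 2)\<rfloor>..\<lfloor>b / (\<epsilon> / 2)\<rfloor>}"
      using assms by (intro floor_div_mem) auto
    then show "cls p \<in> {\<lfloor>- b / (\<epsilon> / 2)\<rfloor>..\<lfloor>b / (\<epsilon> / 2)\<rfloor>} \<times> {1, -1} \<times> {1, -1}"
      unfolding cls_def using A.word_orient_cases[of "fst p"] B.word_orient_cases[of "snd p"] \<open>p \<in> X\<close>
      by (intro SigmaI) (auto simp: X_def mem_Times_iff)
  qed
  then have fin: "finite (cls ` X)"
    by (rule finite_subset) auto
  have "\<forall>p \<in> pwords. \<exists>w. w \<in> pwords \<and> \<bar>defect (cat p w)\<bar> < \<epsilon> / 2 \<and> positive (cat p w)"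
    using exists_correction[of _ "\<epsilon> / 2"] assms half_gt_zero by blast
  from bchoice[OF this] obtain corr where corr: "\<forall>p \<in> pwords.
      corr p \<in> pwords \<and> \<bar>defect (cat p (corr p))\<bar> < \<epsilon> / 2 \<and> positive (cat p (corr p))" ..
  define W where "W = (\<lambda>c. corr (inv_into X cls c)) ` (cls ` X)"
  have inv: "inv_into X cls c \<in> pwords" if "c \<in> cls ` X" for c
    using inv_into_into[OF that] by (simp add: X_def)
  show ?thesis
  proof (intro exI[of _ W] conjI ballI impI)
    show "finite W"
      unfolding W_def using fin by (rule finite_imageI)
    show "W \<subseteq> pwords"
      unfolding W_def using bspec[OF corr inv] by (intro image_subsetI) simp
    fix p assume p: "p \<in> pwords" "\<bar>defect p\<bar> \<le> b"
    then have "p \<in> X"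
      by (simp add: X_def)
    define q where "q = inv_into X cls (cls p)"
    have q: "q \<in> pwords" "cls q = cls p"
      using inv \<open>p \<in> X\<close> by (auto simp: q_def f_inv_into_f)
    have "\<bar>defect p - defect q\<bar> < \<epsilon> / 2"
      using q(2) assms by (intro floor_div_eq_imp_near) (auto simp: cls_def)
    moreover have "\<bar>defect q + defect (corr q)\<bar> < \<epsilon> / 2"
      using bspec[OF corr q(1)] q defect_cat[of q "corr q"] by simp
    ultimately have "\<bar>defect (cat p (corr q))\<bar> < \<epsilon>"
      using p bspec[OF corr q(1)] defect_cat[of p "corr q"] by linarith
    moreover have "positive (cat p (corr q))"
      using bspec[OF corr q(1)] q(2) by (auto simp: positive_def cls_def)
    moreover have "corr q \<in> W"
      using \<open>p \<in> X\<close> by (auto simp: W_def q_def)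
    ultimately show "\<exists>w \<in> W. \<bar>defect (cat p w)\<bar> < \<epsilon> \<and> positive (cat p w)"
      by blast
  qed
qed

subsection \<open>Product stopping sets\<close>

text \<open>The pairs obtained by extending both words of \<open>p\<close> until their ratios drop to \<open>\<rho>\<close>.\<close>

definition pstopped :: "real \<Rightarrow> nat list \<times> nat list \<Rightarrow> (nat list \<times> nat list) set" where
  "pstopped \<rho> p = stopped F \<rho> (fst p) \<times> stopped G \<rho> (snd p)"

lemma pstopped_props:
  assumes "q \<in> pstopped \<rho> p" "0 < \<rho>" "\<rho> < 1"
  shows "q \<in> pwords" "prefix (fst p) (fst q)" "prefix (snd p) (snd q)" "lam q \<le> \<rho>" "gam q \<le> \<rho>"
    "rmin * \<rho> < lam q" "rmin * \<rho> < gam q" "squarish q"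
proof -
  have "fst q \<in> stopped F \<rho> (fst p)" "snd q \<in> stopped G \<rho> (snd p)"
    using assms(1) by (auto simp: pstopped_def)
  note a = A.stopped_bounds[OF this(1) assms(2,3)] and b = B.stopped_bounds[OF this(2) assms(2,3)]
  show q: "q \<in> pwords" and *: "prefix (fst p) (fst q)" "prefix (snd p) (snd q)" "lam q \<le> \<rho>" "gam q \<le> \<rho>"
    using a b by (auto simp: mem_Times_iff)
  have "rmin * \<rho> \<le> A.rmin * \<rho>" "rmin * \<rho> \<le> B.rmin * \<rho>"
    using rmin_bounds assms by (auto intro: mult_right_mono)
  then show **: "rmin * \<rho> < lam q" "rmin * \<rho> < gam q"
    using a b by linarith+
  have "ln rmin + ln \<rho> < ln (lam q)" "ln rmin + ln \<rho> < ln (gam q)"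
    using ** assms rmin_bounds(1) lam_pos[OF q] gam_pos[OF q]
    by (simp_all flip: ln_mult_pos)
  moreover have "ln (lam q) \<le> ln \<rho>" "ln (gam q) \<le> ln \<rho>"
    using * lam_pos[OF q] gam_pos[OF q] assms by simp_all
  ultimately show "squarish q"
    using q by (auto simp: squarish_def defect_def)
qed

lemma finite_pstopped:
  assumes "0 < \<rho>" "p \<in> pwords" "\<rho> < lam p" "\<rho> < gam p"
  shows "finite (pstopped \<rho> p)"
  unfolding pstopped_def using assms by (auto intro!: A.finite_stopped B.finite_stopped)

lemma sum_mass_pstopped:
  assumes "0 < \<rho>" "p \<in> pwords" "\<rho> < lam p" "\<rho> < gam p"
  shows "(\<Sum>q \<in> pstopped \<rho> p. mass q) = mass p"
proof -
  have "(\<Sum>q \<in> pstopped \<rho> p. mass q)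
      = (\<Sum>u \<in> stopped F \<rho> (fst p). A.mass u) * (\<Sum>v \<in> stopped G \<rho> (snd p). B.mass v)"
    unfolding pstopped_def mass_def sum_product sum.cartesian_product by (simp add: case_prod_beta)
  also have "\<dots> = mass p"
    using assms by (auto simp: mass_def A.sum_mass_stopped B.sum_mass_stopped)
  finally show ?thesis .
qed

lemma img_pstopped:
  assumes "0 < \<rho>" "p \<in> pwords" "\<rho> < lam p" "\<rho> < gam p"
  shows "img p = (\<Union>q \<in> pstopped \<rho> p. img q)"
proof -
  have img: "img q = (\<Union>a \<in> word_map F (fst q) ` K. \<Union>b \<in> word_map G (snd q) ` M. {a + b})" for q
    unfolding img_def val_def by blast
  have UN: "(\<Union>a \<in> (\<Union>u \<in> S. f u). \<Union>b \<in> (\<Union>v \<in> T. g v). {a + b})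
      = (\<Union>q \<in> S \<times> T. \<Union>a \<in> f (fst q). \<Union>b \<in> g (snd q). {a + b})"
    for S T :: "nat list set" and f g :: "nat list \<Rightarrow> real set"
    by (simp add: set_eq_iff) blast
  have "word_map F (fst p) ` K = (\<Union>u \<in> stopped F \<rho> (fst p). word_map F u ` K)"
    "word_map G (snd p) ` M = (\<Union>v \<in> stopped G \<rho> (snd p). word_map G v ` M)"
    using assms by (simp_all only: A.image_stopped B.image_stopped mem_Times_iff)
  then show ?thesis
    unfolding img pstopped_def by (simp only: UN)
qed

lemma squarish_Nil: "squarish ([], [])"
  using rmin_bounds by (simp add: squarish_def defect_def)

end

section \<open>Coverings by balls\<close>

text \<open>
  \<open>E\<close> has a finite covering by balls whose radii \<open>r\<close> satisfy \<open>\<Sum> r\<^sup>s \<le> c\<close>.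
\<close>

definition coverable :: "real \<Rightarrow> real set \<Rightarrow> real \<Rightarrow> bool" where
  "coverable s E c \<longleftrightarrow> (\<exists>xs. E \<subseteq> (\<Union>x \<in> set xs. cball (fst x) (snd x)) \<and>
     (\<forall>x \<in> set xs. 0 < snd x) \<and> (\<Sum>x\<leftarrow>xs. snd x powr s) \<le> c)"

lemma coverable_mono: "coverable s E c \<Longrightarrow> E' \<subseteq> E \<Longrightarrow> c \<le> c' \<Longrightarrow> coverable s E' c'"
  unfolding coverable_def by (meson order_trans)

lemma coverable_cball: "E \<subseteq> cball z r \<Longrightarrow> 0 < r \<Longrightarrow> r powr s \<le> c \<Longrightarrow> coverable s E c"
  unfolding coverable_def by (intro exI[of _ "[(z, r)]"]) simp

lemma coverable_empty: "coverable s {} 0"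
  unfolding coverable_def by (intro exI[of _ "[]"]) simp

lemma coverable_Un:
  assumes "coverable s E c" "coverable s E' c'"
  shows "coverable s (E \<union> E') (c + c')"
proof -
  obtain xs ys where
    "E \<subseteq> (\<Union>x \<in> set xs. cball (fst x) (snd x))" "\<forall>x \<in> set xs. 0 < snd x" "(\<Sum>x\<leftarrow>xs. snd x powr s) \<le> c"
    "E' \<subseteq> (\<Union>x \<in> set ys. cball (fst x) (snd x))" "\<forall>x \<in> set ys. 0 < snd x" "(\<Sum>x\<leftarrow>ys. snd x powr s) \<le> c'"
    using assms unfolding coverable_def by blast
  then show ?thesis
    unfolding coverable_def by (intro exI[of _ "xs @ ys"]) auto
qed

lemma coverable_UN:
  assumes "finite I" "\<And>i. i \<in> I \<Longrightarrow> coverable s (E i) (c i)"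
  shows "coverable s (\<Union>i \<in> I. E i) (\<Sum>i \<in> I. c i)"
  using assms by (induction rule: finite_induct) (auto intro: coverable_empty coverable_Un)

section \<open>Nearly coinciding squares\<close>

context self_similar
begin

lemma comparable_imp_eq:
  assumes "prefix x w \<or> prefix w x" "x \<in> words S" "w \<in> words S"
    and "\<bar>ln (word_ratio S x) - ln (word_ratio S w)\<bar> < - ln rmax"
  shows "x = w"
proof -
  have "rmax * word_ratio S x < word_ratio S w"
    if "\<bar>ln (word_ratio S x) - ln (word_ratio S w)\<bar> < - ln rmax" "x \<in> words S" "w \<in> words S" for x w
  proof -
    have "ln (rmax * word_ratio S x) < ln (word_ratio S w)"
      using that word_ratio_pos[of x] rmax_pos by (simp add: ln_mult)
    then show ?thesis
      using that word_ratio_pos[of x] word_ratio_pos[of w] rmax_pos by (simp add: ln_less_cancel_iff)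
  qed
  from this[OF assms(4,2,3)] this[OF _ assms(3,2)] show ?thesis
    using assms prefix_imp_eq[of x w] prefix_imp_eq[of w x] by (auto simp: abs_minus_commute)
qed

end

context ifs_pair
begin

text \<open>
  Relative closeness of near-squares in the form used below: the position is compared with
  \<open>lam p\<close> alone, which suffices because all four ratios are comparable.
\<close>

definition near :: "real \<Rightarrow> nat list \<times> nat list \<Rightarrow> nat list \<times> nat list \<Rightarrow> bool" where
  "near t p q \<longleftrightarrow> p \<in> pwords \<and> q \<in> pwords \<and> \<bar>defect p\<bar> < t \<and>
     \<bar>ln (lam p) - ln (lam q)\<bar> < t \<and> \<bar>ln (gam p) - ln (gam q)\<bar> < t \<and>
     word_orient F (fst p) = word_orient F (fst q) \<and>
     word_orient G (snd p) = word_orient G (snd q) \<and>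
     \<bar>base p - base q\<bar> \<le> t * lam p"

lemma near_mono:
  assumes "near t p q" "t \<le> t'"
  shows "near t' p q"
proof -
  have "t * lam p \<le> t' * lam p"
    using assms lam_pos[of p] by (intro mult_right_mono) (auto simp: near_def)
  then show ?thesis
    using assms unfolding near_def by linarith
qed

lemma near_imp_not_overlap:
  "\<exists>t>0. \<forall>p q. near t p q \<longrightarrow> p \<noteq> q \<longrightarrow> \<not> overlap p q"
proof -
  let ?t = "min (- ln A.rmax) (- ln B.rmax)"
  have "0 < ?t"
    using A.rmax_pos A.rmax_less_1 B.rmax_pos B.rmax_less_1 by simp
  moreover have "\<not> overlap p q" if n: "near ?t p q" and ne: "p \<noteq> q" for p q
  proof
    assume ov: "overlap p q"
    have "fst p = fst q"
      using n ov by (intro A.comparable_imp_eq) (auto simp: near_def overlap_def mem_Times_iff)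
    moreover have "snd p = snd q"
      using n ov by (intro B.comparable_imp_eq) (auto simp: near_def overlap_def mem_Times_iff)
    ultimately show False
      using ne by (simp add: prod_eq_iff)
  qed
  ultimately show ?thesis
    by blast
qed

lemma near_ratios:
  assumes "near t p q" "t \<le> 1"
  shows "\<bar>lam q - lam p\<bar> \<le> 2 * t * lam p" "\<bar>gam p - lam p\<bar> \<le> 2 * t * lam p"
    "\<bar>gam q - gam p\<bar> \<le> 6 * t * lam p"
proof -
  have pos: "0 < lam p" "0 < gam p" "0 < lam q" "0 < gam q"
    using assms lam_pos gam_pos by (auto simp: near_def)
  have t: "0 < t"
    using assms by (auto simp: near_def)
  show "\<bar>lam q - lam p\<bar> \<le> 2 * t * lam p"
    using assms pos by (intro diff_le_of_ln_diff) (auto simp: near_def abs_minus_commute)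
  show *: "\<bar>gam p - lam p\<bar> \<le> 2 * t * lam p"
    using assms pos by (intro diff_le_of_ln_diff) (auto simp: near_def defect_def abs_minus_commute)
  have "\<bar>gam q - gam p\<bar> \<le> 2 * t * gam p"
    using assms pos by (intro diff_le_of_ln_diff) (auto simp: near_def abs_minus_commute)
  also have "\<dots> \<le> 2 * t * (3 * lam p)"
    using assms pos t by (intro mult_left_mono le_3_mult_of_ln_diff)
      (auto simp: near_def defect_def abs_minus_commute)
  finally show "\<bar>gam q - gam p\<bar> \<le> 6 * t * lam p"
    by simp
qed

lemma near_val:
  assumes "near t p q" "t \<le> 1" "x \<in> K" "y \<in> M"
  shows "\<bar>val p x y - val q x y\<bar> \<le> t * (1 + 24 * R) * lam p"
proof -
  note n = near_ratios[OF assms(1,2)]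
  have t: "0 \<le> t * lam p"
    using assms(1) lam_pos[of p] by (auto simp: near_def intro!: mult_nonneg_nonneg)
  have "\<bar>lam p - lam q\<bar> \<le> 6 * (t * lam p)" "\<bar>gam p - gam q\<bar> \<le> 6 * (t * lam p)"
    using n(1,3) t by linarith+
  then have "\<bar>val p x y - val q x y\<bar> \<le> \<bar>base p - base q\<bar> + 4 * R * (6 * (t * lam p))"
    using assms by (intro val_common_suffix) (auto simp: near_def)
  also have "\<bar>base p - base q\<bar> \<le> t * lam p"
    using assms(1) by (simp add: near_def)
  finally show ?thesis
    by (simp add: algebra_simps)
qed

text \<open>
  Near pairs can be taken positively oriented: the correction of \<open>p\<close> is drawn from a finite set
  fixed in advance, so it costs only a constant factor in the precision.
\<close>

lemma exists_positive_near:
  assumes H: "\<And>t. 0 < t \<Longrightarrow> \<exists>p q. p \<noteq> q \<and> near t p q" and "0 < t"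
  shows "\<exists>p q. near t p q \<and> positive p \<and> positive q \<and> \<not> overlap p q"
proof -
  obtain W where W: "finite W" "W \<subseteq> pwords"
    "\<forall>p \<in> pwords. \<bar>defect p\<bar> \<le> 1 \<longrightarrow> (\<exists>w \<in> W. \<bar>defect (cat p w)\<bar> < t \<and> positive (cat p w))"
    using finite_corrections[OF assms(2), of 1] by (elim exE conjE)
  have "0 < lam w" if "w \<in> W" for w
    using lam_pos[OF subsetD[OF W(2) that]] .
  from finite_positive_lower_bound[of W lam, OF W(1) this]
  obtain c where c: "0 < c" "\<And>w. w \<in> W \<Longrightarrow> c \<le> lam w"
    by metis
  obtain t0 where t0: "0 < t0" "\<And>p q. near t0 p q \<Longrightarrow> p \<noteq> q \<Longrightarrow> \<not> overlap p q"
    using near_imp_not_overlap by blast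
  define s where "s = min (min 1 t0) (min t (t * c / (1 + 24 * R)))"
  have s: "0 < s" "s \<le> 1" "s \<le> t0" "s \<le> t" "s \<le> t * c / (1 + 24 * R)"
    using t0 c assms(2) R_pos by (auto simp: s_def)
  then have s': "s * (1 + 24 * R) \<le> t * c"
    using R_pos by (simp add: pos_le_divide_eq)
  obtain p q where pq: "p \<noteq> q" "near s p q"
    using H[OF s(1)] by blast
  have in_pwords: "p \<in> pwords" "q \<in> pwords"
    using pq by (auto simp: near_def)
  have "\<bar>defect p\<bar> \<le> 1"
    using pq s(2) unfolding near_def by linarith
  then obtain w where w: "w \<in> W" "\<bar>defect (cat p w)\<bar> < t" "positive (cat p w)"
    using bspec[OF W(3) in_pwords(1)] by metis
  have w': "w \<in> pwords"
    using subsetD[OF W(2) w(1)] .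
  have "\<bar>base (cat p w) - base (cat q w)\<bar> \<le> s * (1 + 24 * R) * lam p"
    unfolding base_cat using pq(2) s(2) w' A.base_in_K B.base_in_K
    by (intro near_val A.word_map_in_K B.word_map_in_K) auto
  also have "\<dots> \<le> t * c * lam p"
    using s' lam_pos[OF in_pwords(1)] by (intro mult_right_mono) auto
  also have "\<dots> \<le> t * lam w * lam p"
    using c(2)[OF w(1)] assms(2) lam_pos[OF in_pwords(1)] by (intro mult_right_mono mult_left_mono) auto
  finally have "\<bar>base (cat p w) - base (cat q w)\<bar> \<le> t * lam (cat p w)"
    by (simp add: mult_ac)
  moreover have "positive (cat q w)"
    using w(3) pq(2) by (simp add: positive_def near_def)
  moreover have "\<not> overlap (cat p w) (cat q w)"
    using t0(2)[OF near_mono[OF pq(2) s(3)] pq(1)] overlap_cat_imp by blast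
  moreover have "near t p q"
    using near_mono[OF pq(2) s(4)] .
  ultimately have "near t (cat p w) (cat q w)"
    using w w' in_pwords unfolding near_def
    by (simp add: ln_lam_cat ln_gam_cat del: fst_cat snd_cat) simp
  then show ?thesis
    using w \<open>positive (cat q w)\<close> \<open>\<not> overlap (cat p w) (cat q w)\<close> by blast
qed

text \<open>
  A crowd is a family of non-overlapping pairs of nearly the same size \<open>r\<close> in both
  coordinates whose base points lie close to a common point \<open>z\<close>.
\<close>

definition crowd :: "real \<Rightarrow> (nat list \<times> nat list) set \<Rightarrow> real \<Rightarrow> real \<Rightarrow> bool" where
  "crowd \<epsilon> X r z \<longleftrightarrow> finite X \<and> X \<subseteq> pwords \<and> 0 < r \<and>
     (\<forall>f \<in> X. \<forall>g \<in> X. f \<noteq> g \<longrightarrow> \<not> overlap f g) \<and>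
     (\<forall>f \<in> X. \<bar>ln (lam f) - ln r\<bar> \<le> \<epsilon> \<and> \<bar>ln (gam f) - ln r\<bar> \<le> \<epsilon> \<and> \<bar>base f - z\<bar> \<le> \<epsilon> * r)"

lemma inj_cat: "inj_on (cat p) X"
  by (auto simp: inj_on_def cat_def)

text \<open>
  Crowds are doubled by prefixing both members of a near pair. The precision of the prefixes
  has to beat the size \<open>r\<close> of the crowd already constructed, so new pairs go to the front.
\<close>

lemma exists_crowd:
  assumes H: "\<And>t. 0 < t \<Longrightarrow> \<exists>p q. p \<noteq> q \<and> near t p q"
  shows "0 < \<epsilon> \<Longrightarrow> \<exists>X r z. crowd \<epsilon> X r z \<and> card X = 2 ^ n"
proof (induction n arbitrary: \<epsilon>)
  case 0
  have "crowd \<epsilon> {([], [])} 1 (base ([], []))"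
    using 0 by (simp add: crowd_def)
  then show ?case
    by (metis card_1_singleton_iff One_nat_def power_0)
next
  case (Suc n)
  obtain X r z where X: "crowd (\<epsilon> / 2) X r z" "card X = 2 ^ n"
    using Suc.IH[of "\<epsilon> / 2"] Suc.prems by auto
  have r: "0 < r"
    using X by (simp add: crowd_def)
  \<comment> \<open>An error \<open>t\<close> in the prefixes moves base points by up to \<open>t * (1 + 28 * R) * lam p\<close>.\<close>
  define t where "t = min (min 1 (\<epsilon> / 4)) (\<epsilon> * r / (2 * (1 + 28 * R)))"
  have t: "0 < t" "t \<le> 1" "2 * t \<le> \<epsilon> / 2" "t \<le> \<epsilon> * r / (2 * (1 + 28 * R))"
    using Suc.prems r R_pos by (auto simp: t_def)
  then have "t * (2 * (1 + 28 * R)) \<le> \<epsilon> * r"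
    using R_pos by (simp only: pos_le_divide_eq mult_pos_pos zero_less_numeral)
  then have t': "t * (1 + 28 * R) \<le> \<epsilon> / 2 * r"
    by (simp add: algebra_simps)
  obtain p q where pq: "near t p q" "positive p" "positive q" "\<not> overlap p q"
    using exists_positive_near[OF H t(1)] by blast
  have in_pwords: "p \<in> pwords" "q \<in> pwords"
    using pq by (auto simp: near_def)
  define a where "a = lam p"
  have a: "0 < a"
    using lam_pos in_pwords by (simp add: a_def)
  \<comment> \<open>The image of \<open>z\<close> under the similarity that \<open>p\<close> induces approximately on sums \<open>x + y\<close>.\<close>
  define z' where "z' = base p + a * (z - (A.base + B.base))"
  have near_z': "\<bar>base (cat p f) - z'\<bar> \<le> a * (t * (4 * R) + \<epsilon> / 2 * r)"
    "\<bar>base (cat q f) - z'\<bar> \<le> a * (t * (1 + 28 * R) + \<epsilon> / 2 * r)" if f: "f \<in> X" for f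
  proof -
    define x y where "x = word_map F (fst f) A.base" and "y = word_map G (snd f) B.base"
    have xy: "x \<in> K" "y \<in> M"
      using f X A.base_in_K B.base_in_K
      by (auto simp: x_def y_def crowd_def intro!: A.word_map_in_K B.word_map_in_K)
    have base_f: "base f = x + y"
      by (simp add: base_def val_def x_def y_def)
    have 1: "\<bar>val p x y - base p - a * ((x + y) - (A.base + B.base))\<bar> \<le> 2 * R * (2 * t * a)"
      unfolding a_def using pq xy near_ratios[OF pq(1) t(2)] by (intro val_near_square) auto
    have "\<bar>base f - z\<bar> \<le> \<epsilon> / 2 * r"
      using f X by (simp add: crowd_def)
    then have 2: "\<bar>a * (x + y - z)\<bar> \<le> a * (\<epsilon> / 2 * r)"
      using a unfolding base_f by (simp add: abs_mult)
    have 3: "\<bar>val p x y - val q x y\<bar> \<le> t * (1 + 24 * R) * a"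
      unfolding a_def by (rule near_val[OF pq(1) t(2) xy])
    have base: "base (cat p f) = val p x y" "base (cat q f) = val q x y"
      by (simp_all add: base_cat x_def y_def)
    have "val p x y - z' = (val p x y - base p - a * ((x + y) - (A.base + B.base))) + a * (x + y - z)"
      by (simp add: z'_def algebra_simps)
    then have 4: "\<bar>val p x y - z'\<bar> \<le> 2 * R * (2 * t * a) + a * (\<epsilon> / 2 * r)"
      using 1 2 by linarith
    then show "\<bar>base (cat p f) - z'\<bar> \<le> a * (t * (4 * R) + \<epsilon> / 2 * r)"
      unfolding base by (simp add: algebra_simps)
    have "\<bar>val q x y - z'\<bar> \<le> t * (1 + 24 * R) * a + (2 * R * (2 * t * a) + a * (\<epsilon> / 2 * r))"
      using 3 4 by linarith
    then show "\<bar>base (cat q f) - z'\<bar> \<le> a * (t * (1 + 28 * R) + \<epsilon> / 2 * r)"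
      unfolding base by (simp add: algebra_simps)
  qed
  have close_z': "\<bar>base (cat p f) - z'\<bar> \<le> \<epsilon> * (a * r)" "\<bar>base (cat q f) - z'\<bar> \<le> \<epsilon> * (a * r)"
    if f: "f \<in> X" for f
  proof -
    have "t * (4 * R) \<le> t * (1 + 28 * R)"
      using t R_pos by (intro mult_left_mono) auto
    then have "t * (4 * R) + \<epsilon> / 2 * r \<le> \<epsilon> * r" "t * (1 + 28 * R) + \<epsilon> / 2 * r \<le> \<epsilon> * r"
      using t' field_sum_of_halves[of "\<epsilon> * r"] by simp_all
    then have "a * (t * (4 * R) + \<epsilon> / 2 * r) \<le> a * (\<epsilon> * r)"
      "a * (t * (1 + 28 * R) + \<epsilon> / 2 * r) \<le> a * (\<epsilon> * r)"
      using a by (simp_all only: mult_left_mono less_imp_le)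
    then show "\<bar>base (cat p f) - z'\<bar> \<le> \<epsilon> * (a * r)" "\<bar>base (cat q f) - z'\<bar> \<le> \<epsilon> * (a * r)"
      using near_z'[OF f] by (simp_all add: mult_ac)
  qed
  have ln_bounds: "\<bar>ln (lam (cat p' f)) - ln (a * r)\<bar> \<le> \<epsilon>" "\<bar>ln (gam (cat p' f)) - ln (a * r)\<bar> \<le> \<epsilon>"
    if f: "f \<in> X" and p': "p' = p \<or> p' = q" for f p'
  proof -
    have fw: "f \<in> pwords" "p' \<in> pwords"
      using f p' X in_pwords by (auto simp: crowd_def)
    have "\<bar>ln (lam p') - ln a\<bar> \<le> t" "\<bar>ln (gam p') - ln a\<bar> \<le> 2 * t"
      using p' pq(1) t(1) by (auto simp: near_def a_def defect_def)
    moreover have "\<bar>ln (lam f) - ln r\<bar> \<le> \<epsilon> / 2" "\<bar>ln (gam f) - ln r\<bar> \<le> \<epsilon> / 2"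
      using f X by (auto simp: crowd_def)
    moreover have "ln (a * r) = ln a + ln r"
      using a r by (simp add: ln_mult)
    ultimately show "\<bar>ln (lam (cat p' f)) - ln (a * r)\<bar> \<le> \<epsilon>" "\<bar>ln (gam (cat p' f)) - ln (a * r)\<bar> \<le> \<epsilon>"
      using ln_lam_cat[OF fw(2,1)] ln_gam_cat[OF fw(2,1)] t(1,3) by linarith+
  qed
  have no_overlap: "\<not> overlap (cat p f) (cat q g)" "\<not> overlap (cat q g) (cat p f)" for f g
    using pq(4) overlap_cat_imp overlap_sym by blast+
  have "crowd \<epsilon> (cat p ` X \<union> cat q ` X) (a * r) z'"
    unfolding crowd_def
  proof (intro conjI)
    show "finite (cat p ` X \<union> cat q ` X)"
      using X by (simp add: crowd_def)
    show "cat p ` X \<union> cat q ` X \<subseteq> pwords"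
      using X in_pwords by (auto simp: crowd_def cat_def)
    show "\<forall>f\<in>cat p ` X \<union> cat q ` X. \<forall>g\<in>cat p ` X \<union> cat q ` X. f \<noteq> g \<longrightarrow> \<not> overlap f g"
    proof -
      have "f = g \<or> \<not> overlap f g" if "f \<in> X" "g \<in> X" for f g
        using X(1) that unfolding crowd_def by metis
      note disj = this
      show ?thesis
      proof (intro ballI impI)
        fix f g assume "f \<in> cat p ` X \<union> cat q ` X" "g \<in> cat p ` X \<union> cat q ` X" and "f \<noteq> g"
        moreover from this obtain f' g' where "f' \<in> X" "f = cat p f' \<or> f = cat q f'"
          "g' \<in> X" "g = cat p g' \<or> g = cat q g'"
          by blast
        ultimately show "\<not> overlap f g"
          using disj[of f' g'] no_overlap[of f' g'] no_overlap[of g' f'] by (elim disjE) (simp_all, metis+)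
      qed
    qed
    show "\<forall>f\<in>cat p ` X \<union> cat q ` X. \<bar>ln (lam f) - ln (a * r)\<bar> \<le> \<epsilon> \<and>
        \<bar>ln (gam f) - ln (a * r)\<bar> \<le> \<epsilon> \<and> \<bar>base f - z'\<bar> \<le> \<epsilon> * (a * r)"
    proof
      fix g assume "g \<in> cat p ` X \<union> cat q ` X"
      then obtain f where "f \<in> X" "g = cat p f \<or> g = cat q f"
        by blast
      then show "\<bar>ln (lam g) - ln (a * r)\<bar> \<le> \<epsilon> \<and>
          \<bar>ln (gam g) - ln (a * r)\<bar> \<le> \<epsilon> \<and> \<bar>base g - z'\<bar> \<le> \<epsilon> * (a * r)"
        using ln_bounds[of f p] ln_bounds[of f q] close_z'[of f] by metis
    qed
  qed (use a r in simp)
  moreover have "card (cat p ` X \<union> cat q ` X) = 2 ^ Suc n"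
  proof -
    have "cat p ` X \<inter> cat q ` X = {}"
    proof (rule ccontr)
      assume "cat p ` X \<inter> cat q ` X \<noteq> {}"
      then obtain f g where "cat p f = cat q g"
        by blast
      then show False
        using no_overlap(1)[of f g] by (simp only: overlap_refl simp_thms)
    qed
    then show ?thesis
      using X by (simp add: crowd_def card_Un_disjoint card_image[OF inj_cat])
  qed
  ultimately show ?case
    by blast
qed

end

context ifs_pair
begin

section \<open>Relatively close squares make the measure vanish\<close>

lemma powr_le_mass:
  assumes "p \<in> pwords" "0 < m" "m \<le> lam p" "m \<le> gam p"
  shows "m powr (d + d') \<le> mass p"
proof -
  have "m powr (d + d') = m powr d * m powr d'"
    by (rule powr_add)
  also have "\<dots> \<le> lam p powr d * gam p powr d'"
    using assms A.dim_nonneg B.dim_nonneg by (intro mult_mono powr_mono2) auto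
  finally show ?thesis
    by (simp add: mass_def A.mass_def B.mass_def)
qed

lemma mass_le_powr:
  assumes "p \<in> pwords" "lam p \<le> m" "gam p \<le> m"
  shows "mass p \<le> m powr (d + d')"
proof -
  have "lam p powr d * gam p powr d' \<le> m powr d * m powr d'"
    using assms lam_pos[OF assms(1)] gam_pos[OF assms(1)] A.dim_nonneg B.dim_nonneg
    by (intro mult_mono powr_mono2) auto
  also have "\<dots> = m powr (d + d')"
    by (rule powr_add[symmetric])
  finally show ?thesis
    by (simp add: mass_def A.mass_def B.mass_def)
qed

lemma coverable_img_squarish:
  assumes "squarish p"
  shows "coverable (d + d') (img p) ((2 * R * (1 + 1 / rmin)) powr (d + d') * mass p)"
proof -
  have p: "p \<in> pwords" and def: "\<bar>defect p\<bar> \<le> - ln rmin"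
    using assms by (auto simp only: squarish_def)
  note pos = lam_pos[OF p] gam_pos[OF p] rmin_bounds(1)
  have "ln (rmin * lam p) \<le> ln (gam p)" "ln (rmin * gam p) \<le> ln (lam p)"
    using def pos by (auto simp: ln_mult defect_def)
  then have le: "rmin * lam p \<le> gam p" "rmin * gam p \<le> lam p"
    using pos by (simp_all only: ln_le_cancel_iff mult_pos_pos)
  define m where "m = min (lam p) (gam p)"
  have m: "0 < m" "m \<le> lam p" "m \<le> gam p"
    using pos by (auto simp: m_def)
  have "rmin * lam p + rmin * gam p \<le> (1 + rmin) * m"
    using le rmin_bounds(1) by (auto simp: m_def min_def algebra_simps)
  then have "lam p + gam p \<le> (1 + rmin) * m / rmin"
    using pos by (simp add: pos_le_divide_eq algebra_simps)
  also have "\<dots> = (1 + 1 / rmin) * m"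
    using pos by (simp add: field_simps)
  finally have "2 * R * (lam p + gam p) \<le> 2 * R * ((1 + 1 / rmin) * m)"
    using R_pos by (intro mult_left_mono) auto
  then have "img p \<subseteq> cball (base p) (2 * R * (1 + 1 / rmin) * m)"
    using img_subset_cball[OF p] by (auto simp: mult.assoc)
  moreover have "0 < 2 * R * (1 + 1 / rmin) * m"
    using R_pos m pos by (intro mult_pos_pos add_pos_pos) auto
  moreover have "(2 * R * (1 + 1 / rmin) * m) powr (d + d')
      = (2 * R * (1 + 1 / rmin)) powr (d + d') * m powr (d + d')"
    using R_pos m pos by (intro powr_mult)
  then have "(2 * R * (1 + 1 / rmin) * m) powr (d + d')
      \<le> (2 * R * (1 + 1 / rmin)) powr (d + d') * mass p"
    using powr_le_mass[OF p m] by (simp add: mult_left_mono)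
  ultimately show ?thesis
    by (rule coverable_cball)
qed

text \<open>
  A copy of a crowd of \<open>2\<^sup>n\<close> pairs, placed inside a given pair, is covered by a single ball at
  a cost \<open>2\<^sup>n\<close> times smaller than its mass suggests.
\<close>

lemma exists_efficient_part:
  assumes H: "\<And>t. 0 < t \<Longrightarrow> \<exists>p q. p \<noteq> q \<and> near t p q"
  shows "\<exists>\<theta>>0. \<forall>p. squarish p \<longrightarrow> (\<exists>Y. finite Y \<and> Y \<subseteq> pwords \<and>
      (\<forall>g \<in> Y. prefix (fst p) (fst g) \<and> prefix (snd p) (snd g)) \<and>
      (\<forall>f \<in> Y. \<forall>g \<in> Y. f \<noteq> g \<longrightarrow> \<not> overlap f g) \<and>
      \<theta> * mass p \<le> sum mass Y \<and>
      coverable (d + d') (\<Union>g \<in> Y. img g) ((9 * (2 + 24 * R)) powr (d + d') / 2 ^ n * sum mass Y))"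
proof -
  obtain X r z where X: "crowd 1 X r z" "card X = 2 ^ n"
    using exists_crowd[OF H zero_less_one, of n] by metis
  have r: "0 < r" and finX: "finite X" and XP: "X \<subseteq> pwords"
    using X(1) by (auto simp only: crowd_def)
  have "X \<noteq> {}"
    using X(2) by auto
  then obtain f0 where f0: "f0 \<in> X"
    by blast
  have f0': "f0 \<in> pwords"
    using subsetD[OF XP f0] .
  define t where "t = min 1 (r / (4 * R))"
  have t: "0 < t" "t \<le> 1" "t \<le> r / (4 * R)"
    using r R_pos by (auto simp: t_def)
  then have t4: "t * (4 * R) \<le> r"
    using R_pos by (simp only: pos_le_divide_eq mult_pos_pos zero_less_numeral)
  obtain W where W: "finite W" "W \<subseteq> pwords" "\<forall>p \<in> pwords. \<bar>defect p\<bar> \<le> - ln rmin \<longrightarrow>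
      (\<exists>w \<in> W. \<bar>defect (cat p w)\<bar> < t \<and> positive (cat p w))"
    using finite_corrections[OF t(1), of "- ln rmin"] by (elim exE conjE)
  have "0 < mass w" if "w \<in> W" for w
    using mass_pos[OF subsetD[OF W(2) that]] .
  from finite_positive_lower_bound[of W mass, OF W(1) this]
  obtain c where c: "0 < c" "\<And>w. w \<in> W \<Longrightarrow> c \<le> mass w"
    by metis
  define \<theta> where "\<theta> = c * mass f0"
  have "0 < \<theta>"
    using c mass_pos[OF f0'] by (simp add: \<theta>_def)
  moreover have "\<exists>Y. finite Y \<and> Y \<subseteq> pwords \<and>
      (\<forall>g \<in> Y. prefix (fst p) (fst g) \<and> prefix (snd p) (snd g)) \<and>
      (\<forall>f \<in> Y. \<forall>g \<in> Y. f \<noteq> g \<longrightarrow> \<not> overlap f g) \<and>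
      \<theta> * mass p \<le> sum mass Y \<and>
      coverable (d + d') (\<Union>g \<in> Y. img g) ((9 * (2 + 24 * R)) powr (d + d') / 2 ^ n * sum mass Y)"
    if sq: "squarish p" for p
  proof -
    have p: "p \<in> pwords" and "\<bar>defect p\<bar> \<le> - ln rmin"
      using sq by (simp_all only: squarish_def)
    then obtain w where w: "w \<in> W" "\<bar>defect (cat p w)\<bar> < t" "positive (cat p w)"
      using bspec[OF W(3) p] by metis
    have w': "w \<in> pwords"
      using subsetD[OF W(2) w(1)] .
    define p' where "p' = cat p w"
    have p': "p' \<in> pwords"
      unfolding p'_def using p w' by (simp only: cat_in_pwords simp_thms)
    define a where "a = lam p'"
    have a: "0 < a"
      using lam_pos[OF p'] by (simp add: a_def)
    have def_p': "\<bar>ln (gam p') - ln a\<bar> \<le> t"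
      using w(2) by (auto simp: a_def p'_def defect_def abs_minus_commute)
    have gam_p': "\<bar>gam p' - a\<bar> \<le> 2 * t * a"
      using def_p' gam_pos[OF p'] a t by (intro diff_le_of_ln_diff)
    have gam_p'': "gam p' \<le> 3 * a" "a \<le> 3 * gam p'"
      using def_p' gam_pos[OF p'] a t by (auto intro!: le_3_mult_of_ln_diff simp: abs_minus_commute)
    define z' where "z' = base p' + a * (z - (A.base + B.base))"
    have XW: "f \<in> pwords" if "f \<in> X" for f
      using subsetD[OF XP that] .
    have size: "lam (cat p' f) \<le> 3 * (a * r)" "gam (cat p' f) \<le> 9 * (a * r)"
      "a * r / 9 \<le> lam (cat p' f)" "a * r / 9 \<le> gam (cat p' f)" if f: "f \<in> X" for f
    proof -
      have "\<bar>ln (lam f) - ln r\<bar> \<le> 1" "\<bar>ln (gam f) - ln r\<bar> \<le> 1"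
        using X(1) f by (auto simp: crowd_def)
      then have "lam f \<le> 3 * r" "r \<le> 3 * lam f" "gam f \<le> 3 * r" "r \<le> 3 * gam f"
        using lam_pos[OF XW[OF f]] gam_pos[OF XW[OF f]] r
        by (auto intro!: le_3_mult_of_ln_diff simp: abs_minus_commute)
      note b = this
      have "a * lam f \<le> a * (3 * r)" "a * r \<le> a * (3 * lam f)"
        using b a by (simp_all only: mult_left_mono less_imp_le)
      moreover have "gam p' * gam f \<le> (3 * a) * (3 * r)" "a * r \<le> (3 * gam p') * (3 * gam f)"
        using b a r gam_p'' gam_pos[OF p'] gam_pos[OF XW[OF f]] by (intro mult_mono; simp)+
      moreover have "0 < a * lam f"
        using a lam_pos[OF XW[OF f]] by simp
      ultimately show "lam (cat p' f) \<le> 3 * (a * r)" "gam (cat p' f) \<le> 9 * (a * r)"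
        "a * r / 9 \<le> lam (cat p' f)" "a * r / 9 \<le> gam (cat p' f)"
        by (simp_all add: a_def)
    qed
    have base_close: "\<bar>base (cat p' f) - z'\<bar> \<le> 2 * (a * r)" if f: "f \<in> X" for f
    proof -
      define x y where "x = word_map F (fst f) A.base" and "y = word_map G (snd f) B.base"
      have xy: "x \<in> K" "y \<in> M"
        using XW[OF f] A.base_in_K B.base_in_K
        by (auto simp: x_def y_def mem_Times_iff intro!: A.word_map_in_K B.word_map_in_K)
      have base_f: "base f = x + y" "base (cat p' f) = val p' x y"
        by (simp_all add: base_def val_def x_def y_def word_map_append)
      have 1: "\<bar>val p' x y - base p' - a * ((x + y) - (A.base + B.base))\<bar> \<le> 2 * R * (2 * t * a)"
        unfolding a_def using w(3) xy gam_p' by (intro val_near_square) (auto simp: p'_def a_def)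
      have "\<bar>base f - z\<bar> \<le> r"
        using f X(1) by (simp add: crowd_def)
      then have 2: "\<bar>a * (x + y - z)\<bar> \<le> a * r"
        using a unfolding base_f by (simp add: abs_mult)
      have "a * (t * (4 * R)) \<le> a * r"
        using t4 a by (intro mult_left_mono) auto
      then have 3: "2 * R * (2 * t * a) \<le> a * r"
        by (simp add: mult_ac)
      have "val p' x y - z' = (val p' x y - base p' - a * ((x + y) - (A.base + B.base))) + a * (x + y - z)"
        by (simp add: z'_def algebra_simps)
      then show ?thesis
        using 1 2 3 unfolding base_f by linarith
    qed
    define Y where "Y = cat p' ` X"
    have cardY: "card Y = 2 ^ n"
      unfolding Y_def using X(2) by (simp add: card_image[OF inj_cat])
    have finY: "finite Y"
      using finX by (simp add: Y_def)
    have YP: "Y \<subseteq> pwords"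
      unfolding Y_def
    proof (rule image_subsetI)
      show "cat p' f \<in> pwords" if "f \<in> X" for f
        using XW[OF that] p' by (simp only: cat_in_pwords simp_thms)
    qed
    have pre: "\<forall>g \<in> Y. prefix (fst p) (fst g) \<and> prefix (snd p) (snd g)"
      by (simp add: Y_def p'_def)
    have disj: "\<forall>f \<in> Y. \<forall>g \<in> Y. f \<noteq> g \<longrightarrow> \<not> overlap f g"
    proof (intro ballI impI)
      fix f g assume "f \<in> Y" "g \<in> Y" "f \<noteq> g"
      then obtain f' g' where *: "f = cat p' f'" "g = cat p' g'" "f' \<in> X" "g' \<in> X" "f' \<noteq> g'"
        unfolding Y_def by blast
      then show "\<not> overlap f g"
        using X(1) by (simp add: crowd_def)
    qed
    have "cat p' f0 \<in> Y"
      using f0 by (simp add: Y_def)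
    then have "mass (cat p' f0) \<le> sum mass Y"
      using finY mass_pos[OF subsetD[OF YP]] by (intro member_le_sum) (auto intro: less_imp_le)
    moreover have "mass (cat p' f0) = mass p * mass w * mass f0"
      using p p' w' f0' by (simp only: mass_cat p'_def)
    moreover have "mass p * c * mass f0 \<le> mass p * mass w * mass f0"
      using c(2)[OF w(1)] mass_pos[OF p] mass_pos[OF f0'] by simp
    ultimately have large: "\<theta> * mass p \<le> sum mass Y"
      by (simp add: \<theta>_def mult_ac)
    have "(\<Union>g \<in> Y. img g) \<subseteq> cball z' ((2 + 24 * R) * (a * r))"
    proof (rule UN_least)
      fix g assume "g \<in> Y"
      then obtain f where f: "f \<in> X" "g = cat p' f"
        unfolding Y_def by blast
      have "lam g + gam g \<le> 12 * (a * r)"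
        using size(1,2)[OF f(1)] unfolding f(2) by linarith
      then have "2 * R * (lam g + gam g) \<le> 2 * R * (12 * (a * r))"
        using R_pos by (intro mult_left_mono) auto
      then have le: "2 * R * (lam g + gam g) + 2 * (a * r) \<le> (2 + 24 * R) * (a * r)"
        by (simp add: algebra_simps)
      show "img g \<subseteq> cball z' ((2 + 24 * R) * (a * r))"
      proof
        fix y assume "y \<in> img g"
        then have "\<bar>y - base g\<bar> \<le> 2 * R * (lam g + gam g)"
          using img_subset_cball[OF subsetD[OF YP \<open>g \<in> Y\<close>]]
          by (auto simp: dist_real_def abs_minus_commute)
        then have "\<bar>z' - y\<bar> \<le> (2 + 24 * R) * (a * r)"
          using base_close[OF f(1)] le unfolding f(2) by linarith
        then show "y \<in> cball z' ((2 + 24 * R) * (a * r))"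
          by (simp add: dist_real_def)
      qed
    qed
    moreover have "0 < (2 + 24 * R) * (a * r)"
      using R_pos a r by (intro mult_pos_pos) auto
    moreover have "((2 + 24 * R) * (a * r)) powr (d + d')
        \<le> (9 * (2 + 24 * R)) powr (d + d') / 2 ^ n * sum mass Y"
    proof -
      have "(a * r / 9) powr (d + d') \<le> mass g" if g: "g \<in> Y" for g
      proof -
        obtain f where f: "f \<in> X" "g = cat p' f"
          using g unfolding Y_def by blast
        show ?thesis
          using size(3,4)[OF f(1)] a r unfolding f(2)[symmetric]
          by (intro powr_le_mass subsetD[OF YP g]) auto
      qed
      then have "(\<Sum>g \<in> Y. (a * r / 9) powr (d + d')) \<le> sum mass Y"
        by (rule sum_mono)
      then have *: "2 ^ n * (a * r / 9) powr (d + d') \<le> sum mass Y"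
        by (simp add: cardY)
      have "(2 + 24 * R) * (a * r) = 9 * (2 + 24 * R) * (a * r / 9)"
        by simp
      then have "((2 + 24 * R) * (a * r)) powr (d + d')
          = (9 * (2 + 24 * R) * (a * r / 9)) powr (d + d')"
        by (rule arg_cong)
      also have "\<dots> = (9 * (2 + 24 * R)) powr (d + d') * (a * r / 9) powr (d + d')"
        using R_pos a r by (intro powr_mult)
      also have "\<dots> \<le> (9 * (2 + 24 * R)) powr (d + d') * (sum mass Y / 2 ^ n)"
        using * by (intro mult_left_mono) (simp_all add: field_simps)
      finally show ?thesis
        by simp
    qed
    ultimately have "coverable (d + d') (\<Union>g \<in> Y. img g)
        ((9 * (2 + 24 * R)) powr (d + d') / 2 ^ n * sum mass Y)"
      by (rule coverable_cball)
    then show ?thesis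
      using finY YP pre disj large by metis
  qed
  ultimately show ?thesis
    by metis
qed

text \<open>The rest of a pair after removal of such a part is again a union of squarish pairs.\<close>

lemma coverable_part_and_rest:
  assumes sq: "squarish p" and finY: "finite Y" and YP: "Y \<subseteq> pwords"
    and pre: "\<forall>g \<in> Y. prefix (fst p) (fst g) \<and> prefix (snd p) (snd g)"
    and disj: "\<forall>f \<in> Y. \<forall>g \<in> Y. f \<noteq> g \<longrightarrow> \<not> overlap f g"
    and cov: "coverable s (\<Union>g \<in> Y. img g) b"
    and rest: "\<And>q. squarish q \<Longrightarrow> coverable s (img q) (c * mass q)"
  shows "coverable s (img p) (b + c * (mass p - sum mass Y))"
proof -
  have p: "p \<in> pwords"
    using sq by (simp only: squarish_def)
  have "0 < min (lam q) (gam q)" if "q \<in> insert p Y" for q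
  proof -
    have "q \<in> pwords"
      using that p subsetD[OF YP, of q] by (simp only: insert_iff) metis
    then show ?thesis
      using lam_pos gam_pos by simp
  qed
  from finite_positive_lower_bound[of "insert p Y" "\<lambda>q. min (lam q) (gam q)", OF _ this] finY
  obtain e where e: "0 < e" "e \<le> 1" "\<And>q. q \<in> insert p Y \<Longrightarrow> e \<le> min (lam q) (gam q)"
    by (metis finite_insert)
  \<comment> \<open>Stopping below the size of all members of \<open>Y\<close> refines \<open>p\<close> and every member simultaneously.\<close>
  define \<rho> where "\<rho> = e / 2"
  have \<rho>: "0 < \<rho>" "\<rho> < 1" "\<rho> < e"
    using e by (auto simp: \<rho>_def)
  have big: "\<rho> < lam q" "\<rho> < gam q" if "q \<in> insert p Y" for q
    using e(3)[OF that] \<rho>(3) by linarith+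
  note big_p = big[OF insertI1] and big_Y = big[OF insertI2]
  let ?P = "pstopped \<rho> p" and ?U = "\<Union>g \<in> Y. pstopped \<rho> g"
  have finP: "finite ?P"
    by (rule finite_pstopped[OF \<rho>(1) p big_p])
  have fing: "finite (pstopped \<rho> g)" if "g \<in> Y" for g
    by (rule finite_pstopped[OF \<rho>(1) subsetD[OF YP that] big_Y[OF that]])
  have UP: "?U \<subseteq> ?P"
  proof (rule UN_least)
    fix g assume "g \<in> Y"
    then have "prefix (fst p) (fst g)" "prefix (snd p) (snd g)"
      using bspec[OF pre] by auto
    then show "pstopped \<rho> g \<subseteq> ?P"
      unfolding pstopped_def stopped_def by (auto intro: prefix_order.trans)
  qed
  have "sum mass ?U = (\<Sum>g \<in> Y. sum mass (pstopped \<rho> g))"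
  proof (rule sum.UNION_disjoint)
    show "\<forall>f\<in>Y. \<forall>g\<in>Y. f \<noteq> g \<longrightarrow> pstopped \<rho> f \<inter> pstopped \<rho> g = {}"
    proof (intro ballI impI, rule ccontr)
      fix f g assume fg: "f \<in> Y" "g \<in> Y" "f \<noteq> g" and "pstopped \<rho> f \<inter> pstopped \<rho> g \<noteq> {}"
      then obtain q where q: "q \<in> pstopped \<rho> f" "q \<in> pstopped \<rho> g"
        by blast
      have "overlap f g"
        using overlap_of_common_extension pstopped_props(2,3)[OF q(1) \<rho>(1,2)]
          pstopped_props(2,3)[OF q(2) \<rho>(1,2)] by metis
      then show False
        using disj fg by metis
    qed
  qed (use finY fing in blast)+
  also have "\<dots> = sum mass Y"
    using sum_mass_pstopped[OF \<rho>(1) subsetD[OF YP] big_Y] by (intro sum.cong) auto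
  finally have "sum mass (?P - ?U) = mass p - sum mass Y"
    using sum_diff[OF finP UP, of mass] sum_mass_pstopped[OF \<rho>(1) p big_p] by simp
  moreover have "coverable s (\<Union>q \<in> ?P - ?U. img q) (\<Sum>q \<in> ?P - ?U. c * mass q)"
    using finP by (intro coverable_UN rest pstopped_props(8)[OF _ \<rho>(1,2)]) blast+
  ultimately have "coverable s (\<Union>q \<in> ?P - ?U. img q) (c * (mass p - sum mass Y))"
    by (simp flip: sum_distrib_left)
  from coverable_Un[OF cov this] show ?thesis
  proof (rule coverable_mono)
    have "img q \<subseteq> (\<Union>g \<in> Y. img g) \<union> (\<Union>q \<in> ?P - ?U. img q)" if "q \<in> ?P" for q
    proof (cases "q \<in> ?U")
      case True
      then obtain g where g: "g \<in> Y" "q \<in> pstopped \<rho> g"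
        by blast
      have "img q \<subseteq> img g"
        unfolding img_pstopped[OF \<rho>(1) subsetD[OF YP g(1)] big_Y[OF g(1)]] using g(2) by blast
      then show ?thesis
        using g(1) by blast
    next
      case False
      then show ?thesis
        using that by blast
    qed
    then show "img p \<subseteq> (\<Union>g \<in> Y. img g) \<union> (\<Union>q \<in> ?P - ?U. img q)"
      unfolding img_pstopped[OF \<rho>(1) p big_p] by (rule UN_least)
  qed simp
qed

text \<open>
  The optimal constant \<open>i\<close> in \<open>coverable (d + d') (img p) (i * mass p)\<close>, uniformly over squarish
  pairs, cannot exceed the cost rate of the efficient parts: otherwise covering an efficient
  part first and the rest with constant almost \<open>i\<close> would improve on \<open>i\<close>.
\<close>

lemma coverable_arbitrarily_small:
  assumes H: "\<And>t. 0 < t \<Longrightarrow> \<exists>p q. p \<noteq> q \<and> near t p q" and "0 < \<eta>" "squarish p"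
  shows "coverable (d + d') (img p) (\<eta> * mass p)"
proof -
  define Cs where "Cs = {c. 0 \<le> c \<and> (\<forall>p. squarish p \<longrightarrow> coverable (d + d') (img p) (c * mass p))}"
  define i where "i = Inf Cs"
  define C where "C = (9 * (2 + 24 * R)) powr (d + d')"
  have "(2 * R * (1 + 1 / rmin)) powr (d + d') \<in> Cs"
    by (simp add: Cs_def coverable_img_squarish)
  then have ne: "Cs \<noteq> {}"
    by blast
  have bdd: "bdd_below Cs"
    by (rule bdd_belowI[of _ 0]) (simp add: Cs_def)
  have i_le: "i \<le> c" if "c \<in> Cs" for c
    unfolding i_def using that bdd by (rule cInf_lower)
  have "i \<le> C / 2 ^ n" for n
  proof (rule ccontr)
    define b where "b = C / 2 ^ n"
    assume "\<not> i \<le> C / 2 ^ n"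
    then have "b < i"
      by (simp add: b_def)
    have b0: "0 \<le> b"
      by (simp add: b_def C_def)
    obtain \<theta> where \<theta>: "0 < \<theta>" "\<forall>p. squarish p \<longrightarrow> (\<exists>Y. finite Y \<and> Y \<subseteq> pwords \<and>
      (\<forall>g \<in> Y. prefix (fst p) (fst g) \<and> prefix (snd p) (snd g)) \<and>
      (\<forall>f \<in> Y. \<forall>g \<in> Y. f \<noteq> g \<longrightarrow> \<not> overlap f g) \<and>
      \<theta> * mass p \<le> sum mass Y \<and>
      coverable (d + d') (\<Union>g \<in> Y. img g) (b * sum mass Y))"
      using exists_efficient_part[OF H, of n] unfolding b_def C_def by metis
    have "i < i + min 1 \<theta> * (i - b)"
      using \<theta>(1) \<open>b < i\<close> by simp
    then obtain c where c: "c \<in> Cs" "c < i + min 1 \<theta> * (i - b)"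
      using cInf_lessD[OF ne] unfolding i_def[symmetric] by metis
    \<comment> \<open>The constant achieved by covering a part of relative mass \<open>\<theta>\<close> at rate \<open>b\<close>, the rest at rate \<open>c\<close>;
      \<open>c\<close> is so close to \<open>i\<close> that it falls below \<open>i\<close>.\<close>
    define c' where "c' = c - min 1 \<theta> * (c - b)"
    have "i \<le> c"
      by (rule i_le[OF c(1)])
    then have "b < c"
      using \<open>b < i\<close> by simp
    have "min 1 \<theta> * (c - b) \<le> 1 * (c - b)"
      using \<open>b < c\<close> by (intro mult_right_mono) auto
    then have "0 \<le> c'"
      using b0 by (simp add: c'_def)
    moreover have "coverable (d + d') (img p) (c' * mass p)" if sq: "squarish p" for p
    proof -
      obtain Y where Y: "finite Y" "Y \<subseteq> pwords"
        "\<forall>g \<in> Y. prefix (fst p) (fst g) \<and> prefix (snd p) (snd g)"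
        "\<forall>f \<in> Y. \<forall>g \<in> Y. f \<noteq> g \<longrightarrow> \<not> overlap f g"
        "\<theta> * mass p \<le> sum mass Y"
        "coverable (d + d') (\<Union>g \<in> Y. img g) (b * sum mass Y)"
        using \<theta>(2) sq by metis
      have "coverable (d + d') (img p) (b * sum mass Y + c * (mass p - sum mass Y))"
        using c(1) unfolding Cs_def by (intro coverable_part_and_rest[OF sq Y(1-4,6)]) blast
      moreover have "b * sum mass Y + c * (mass p - sum mass Y) \<le> c' * mass p"
      proof -
        have "p \<in> pwords"
          using sq by (simp only: squarish_def)
        then have "min 1 \<theta> * mass p \<le> \<theta> * mass p"
          using mass_pos[of p] by (intro mult_right_mono) auto
        then have "(c - b) * (min 1 \<theta> * mass p) \<le> (c - b) * sum mass Y"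
          using Y(5) \<open>b < c\<close> by (intro mult_left_mono) auto
        then show ?thesis
          by (simp add: c'_def algebra_simps)
      qed
      ultimately show ?thesis
        by (rule coverable_mono[OF _ subset_refl])
    qed
    ultimately have "c' \<in> Cs"
      by (simp add: Cs_def)
    then have "i \<le> c'"
      by (rule i_le)
    also have "c' \<le> c - min 1 \<theta> * (i - b)"
      using \<open>i \<le> c\<close> \<theta>(1) by (simp add: c'_def mult_left_mono)
    finally show False
      using c(2) by simp
  qed
  moreover have "(\<lambda>n. C / 2 ^ n) \<longlonglongrightarrow> 0"
    by (rule LIMSEQ_divide_realpow_zero) simp
  ultimately have "i \<le> 0"
    by (intro LIMSEQ_le_const) auto
  then have "Inf Cs < \<eta>"
    using assms(2) by (simp add: i_def)
  then obtain c where c: "c \<in> Cs" "c < \<eta>"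
    using cInf_lessD[OF ne] by metis
  have "coverable (d + d') (img p) (c * mass p)"
    using c(1) assms(3) unfolding Cs_def by blast
  moreover have "p \<in> pwords"
    using assms(3) by (simp only: squarish_def)
  then have "c * mass p \<le> \<eta> * mass p"
    using c(2) mass_pos[of p] by (intro mult_right_mono) auto
  ultimately show ?thesis
    by (rule coverable_mono[OF _ subset_refl])
qed

end

section \<open>Positivity of the measure in the absence of relatively close squares\<close>

lemma sum_UN_le:
  fixes f :: "'b \<Rightarrow> real"
  assumes "finite I" "\<And>i. i \<in> I \<Longrightarrow> finite (A i)" "\<And>x. 0 \<le> f x"
  shows "sum f (\<Union>i \<in> I. A i) \<le> (\<Sum>i \<in> I. sum f (A i))"
  using assms
proof (induction rule: finite_induct)
  case (insert j I)
  have "sum f (A j \<union> (\<Union>i \<in> I. A i)) + sum f (A j \<inter> (\<Union>i \<in> I. A i))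
      = sum f (A j) + sum f (\<Union>i \<in> I. A i)"
    using insert by (intro sum.union_inter) auto
  moreover have "0 \<le> sum f (A j \<inter> (\<Union>i \<in> I. A i))"
    using insert by (intro sum_nonneg) auto
  ultimately show ?case
    using insert by simp
qed simp

context ifs_pair
begin

lemma is_square_iff: "p \<in> pwords \<Longrightarrow> is_square F G t p \<longleftrightarrow> \<bar>defect p\<bar> < t"
  using ratio_near_iff[OF lam_pos gam_pos, of p p t]
  by (simp add: is_square_def defect_def case_prod_beta)

lemma sum_coding_pad_ones: "sum_coding F G (pad_ones (fst p), pad_ones (snd p)) = base p"
  by (simp add: sum_coding_def A.coding_map_pad_ones B.coding_map_pad_ones base_def val_def)

lemma relatively_close_iff:
  assumes "p \<in> pwords" "q \<in> pwords"
  shows "relatively_close F G D t p q \<longleftrightarrow>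
    \<bar>ln (lam p) - ln (lam q)\<bar> < t \<and> \<bar>ln (gam p) - ln (gam q)\<bar> < t \<and>
    word_orient F (fst p) = word_orient F (fst q) \<and> word_orient G (snd p) = word_orient G (snd q) \<and>
    \<bar>base p - base q\<bar> < t * D * Min {lam p, lam q, gam p, gam q}"
  using ratio_near_iff[OF lam_pos lam_pos, OF assms, of t] ratio_near_iff[OF gam_pos gam_pos, OF assms, of t]
  by (simp only: relatively_close_def case_prod_beta sum_coding_pad_ones)

text \<open>
  Without relatively close squares, boundedly many stopped pairs of size \<open>\<rho>\<close> have base points in
  an interval of length comparable to \<open>\<rho>\<close>: sort them by ratios, orientations and base point; two
  members of the same class, both extended by the correction of one of them, are relatively close
  squares.
\<close>

lemma bounded_multiplicity:
  assumes none: "\<forall>p \<in> pwords. \<forall>q \<in> pwords. p \<noteq> q \<longrightarrow>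
      is_square F G \<epsilon> p \<longrightarrow> is_square F G \<epsilon> q \<longrightarrow> \<not> relatively_close F G D \<epsilon> p q"
    and "0 < \<epsilon>" "0 < D"
  shows "\<exists>N::nat. \<forall>\<rho> z. 0 < \<rho> \<longrightarrow> \<rho> < 1 \<longrightarrow>
    card {p \<in> pstopped \<rho> ([], []). \<bar>base p - z\<bar> \<le> b * \<rho>} \<le> N"
proof -
  have half: "0 < \<epsilon> / 2"
    using assms(2) by simp
  obtain W where W: "finite W" "W \<subseteq> pwords" "\<forall>p \<in> pwords. \<bar>defect p\<bar> \<le> - ln rmin \<longrightarrow>
      (\<exists>w \<in> W. \<bar>defect (cat p w)\<bar> < \<epsilon> / 2 \<and> positive (cat p w))"
    using finite_corrections[OF half, of "- ln rmin"] by (elim exE conjE)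
  have "0 < min (lam w) (gam w)" if "w \<in> W" for w
    using lam_pos[OF subsetD[OF W(2) that]] gam_pos[OF subsetD[OF W(2) that]] by simp
  from finite_positive_lower_bound[of W "\<lambda>w. min (lam w) (gam w)", OF W(1) this]
  obtain c where c: "0 < c" "\<And>w. w \<in> W \<Longrightarrow> c \<le> min (lam w) (gam w)"
    by metis
  define e where "e = \<epsilon> * D * (c * rmin)"
  have e: "0 < e"
    using assms(2,3) c(1) rmin_bounds by (simp add: e_def)
  define t where "t = min (min 1 (\<epsilon> / 4)) (e / (2 * (1 + 8 * R)))"
  have t: "0 < t" "t \<le> 1" "2 * t \<le> \<epsilon> / 2" "t \<le> e / (2 * (1 + 8 * R))"
    using assms(2) e R_pos by (auto simp: t_def)
  then have "t * (2 * (1 + 8 * R)) \<le> e"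
    using R_pos by (simp only: pos_le_divide_eq mult_pos_pos zero_less_numeral)
  then have t': "t * (1 + 8 * R) < e"
    using e by (simp add: algebra_simps)
  define T where "T = {\<lfloor>ln rmin / t\<rfloor>..\<lfloor>0 / t\<rfloor>} \<times> {\<lfloor>ln rmin / t\<rfloor>..\<lfloor>0 / t\<rfloor>} \<times> {1::real, -1} \<times> {1::real, -1} \<times>
    {\<lfloor>- b / t\<rfloor>..\<lfloor>b / t\<rfloor>}"
  have finT: "finite T"
    by (simp add: T_def)
  have "card {p \<in> pstopped \<rho> ([], []). \<bar>base p - z\<bar> \<le> b * \<rho>} \<le> card T" if \<rho>: "0 < \<rho>" "\<rho> < 1" for \<rho> z
  proof -
    define Z where "Z = {p \<in> pstopped \<rho> ([], []). \<bar>base p - z\<bar> \<le> b * \<rho>}"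
    define cls where "cls p = (\<lfloor>(ln (lam p) - ln \<rho>) / t\<rfloor>, \<lfloor>(ln (gam p) - ln \<rho>) / t\<rfloor>,
      word_orient F (fst p), word_orient G (snd p), \<lfloor>((base p - z) / \<rho>) / t\<rfloor>)" for p
    have ZP: "p \<in> pwords" "lam p \<le> \<rho>" "gam p \<le> \<rho>" "rmin * \<rho> < lam p" "rmin * \<rho> < gam p" "squarish p"
      and Zb: "\<bar>base p - z\<bar> \<le> b * \<rho>"
      if "p \<in> Z" for p
      using that pstopped_props(1,4-8)[OF _ \<rho>] unfolding Z_def by blast+
    have inj: "inj_on cls Z"
    proof (rule inj_onI, rule ccontr)
      fix p q assume pq: "p \<in> Z" "q \<in> Z" "cls p = cls q" and "p \<noteq> q"
      note p = ZP[OF pq(1)] and q = ZP[OF pq(2)]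
      have "\<bar>(ln (lam p) - ln \<rho>) - (ln (lam q) - ln \<rho>)\<bar> < t"
        "\<bar>(ln (gam p) - ln \<rho>) - (ln (gam q) - ln \<rho>)\<bar> < t"
        "\<bar>(base p - z) / \<rho> - (base q - z) / \<rho>\<bar> < t"
        using pq(3) t(1) unfolding cls_def prod.inject by (intro floor_div_eq_imp_near; metis)+
      then have ln_near: "\<bar>ln (lam p) - ln (lam q)\<bar> < t" "\<bar>ln (gam p) - ln (gam q)\<bar> < t"
        and "\<bar>base p - base q\<bar> / \<rho> < t"
        using \<rho> by (simp_all flip: diff_divide_distrib)
      then have base_near: "\<bar>base p - base q\<bar> < t * \<rho>"
        using \<rho> by (simp add: pos_divide_less_eq)
      have orient: "word_orient F (fst p) = word_orient F (fst q)"
        "word_orient G (snd p) = word_orient G (snd q)"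
        using pq(3) by (simp_all add: cls_def)
      have "\<bar>lam p - lam q\<bar> \<le> 2 * t * lam q" "\<bar>gam p - gam q\<bar> \<le> 2 * t * gam q"
        using ln_near t lam_pos[OF p(1)] lam_pos[OF q(1)] gam_pos[OF p(1)] gam_pos[OF q(1)]
        by (auto intro!: diff_le_of_ln_diff)
      moreover have "2 * t * lam q \<le> 2 * t * \<rho>" "2 * t * gam q \<le> 2 * t * \<rho>"
        using q t by simp_all
      ultimately have ratio_near: "\<bar>lam p - lam q\<bar> \<le> 2 * t * \<rho>" "\<bar>gam p - gam q\<bar> \<le> 2 * t * \<rho>"
        by linarith+
      have "\<bar>defect p\<bar> \<le> - ln rmin"
        using p(6) by (simp only: squarish_def)
      then obtain w where w: "w \<in> W" "\<bar>defect (cat p w)\<bar> < \<epsilon> / 2"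
        using bspec[OF W(3) p(1)] by metis
      have w': "w \<in> pwords"
        using subsetD[OF W(2) w(1)] .
      have cats: "cat p w \<in> pwords" "cat q w \<in> pwords"
        using p(1) q(1) w' by (simp_all only: cat_in_pwords simp_thms)
      have "defect (cat q w) = defect (cat p w) - (ln (lam p) - ln (lam q)) + (ln (gam p) - ln (gam q))"
        using p(1) q(1) w' by (simp only: defect_cat) (simp add: defect_def)
      then have "\<bar>defect (cat p w)\<bar> < \<epsilon>" "\<bar>defect (cat q w)\<bar> < \<epsilon>"
        using w(2) ln_near t(1,3) by linarith+
      then have squares: "is_square F G \<epsilon> (cat p w)" "is_square F G \<epsilon> (cat q w)"
        using is_square_iff[OF cats(1)] is_square_iff[OF cats(2)] by metis+
      have "\<bar>base (cat p w) - base (cat q w)\<bar> \<le> \<bar>base p - base q\<bar> + 4 * R * (2 * t * \<rho>)"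
        unfolding base_cat using w' A.base_in_K B.base_in_K
        by (intro val_common_suffix[OF p(1) q(1) _ _ orient ratio_near])
          (auto simp: mem_Times_iff intro!: A.word_map_in_K B.word_map_in_K)
      also have "\<dots> \<le> t * (1 + 8 * R) * \<rho>"
        using base_near by (simp add: algebra_simps)
      also have "\<dots> < e * \<rho>"
        using t' \<rho> by simp
      also have "\<dots> = \<epsilon> * D * (rmin * \<rho> * c)"
        by (simp add: e_def mult_ac)
      also have "\<dots> \<le> \<epsilon> * D * Min {lam (cat p w), lam (cat q w), gam (cat p w), gam (cat q w)}"
      proof (rule mult_left_mono)
        have "rmin * \<rho> * c \<le> lam p * lam w" "rmin * \<rho> * c \<le> lam q * lam w"
          "rmin * \<rho> * c \<le> gam p * gam w" "rmin * \<rho> * c \<le> gam q * gam w"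
          using p(4,5) q(4,5) c(1) c(2)[OF w(1)] rmin_bounds(1) \<rho>(1)
          by (auto intro!: mult_mono less_imp_le[OF lam_pos] less_imp_le[OF gam_pos] p(1) q(1))
        then show "rmin * \<rho> * c \<le> Min {lam (cat p w), lam (cat q w), gam (cat p w), gam (cat q w)}"
          by simp
      qed (use assms(2,3) in simp)
      finally have base_close: "\<bar>base (cat p w) - base (cat q w)\<bar>
          < \<epsilon> * D * Min {lam (cat p w), lam (cat q w), gam (cat p w), gam (cat q w)}" .
      have "\<bar>ln (lam (cat p w)) - ln (lam (cat q w))\<bar> < \<epsilon>" "\<bar>ln (gam (cat p w)) - ln (gam (cat q w))\<bar> < \<epsilon>"
        unfolding ln_lam_cat[OF p(1) w'] ln_lam_cat[OF q(1) w'] ln_gam_cat[OF p(1) w'] ln_gam_cat[OF q(1) w']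
        using ln_near t(1,3) by linarith+
      then have "relatively_close F G D \<epsilon> (cat p w) (cat q w)"
        unfolding relatively_close_iff[OF cats] using orient base_close by simp
      moreover have "cat p w \<noteq> cat q w"
        using \<open>p \<noteq> q\<close> by (simp add: cat_def prod_eq_iff)
      ultimately show False
        using bspec[OF bspec[OF none cats(1)] cats(2)] squares by metis
    qed
    have "cls ` Z \<subseteq> T"
    proof (rule image_subsetI)
      fix p assume "p \<in> Z"
      note p = ZP[OF this] and pb = Zb[OF this]
      note pos = lam_pos[OF p(1)] gam_pos[OF p(1)]
      have "ln (rmin * \<rho>) \<le> ln (lam p)" "ln (rmin * \<rho>) \<le> ln (gam p)"
        "ln (lam p) \<le> ln \<rho>" "ln (gam p) \<le> ln \<rho>"
        using p pos \<rho> rmin_bounds(1) by simp_all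
      moreover have "ln (rmin * \<rho>) = ln rmin + ln \<rho>"
        using \<rho> rmin_bounds(1) by (simp add: ln_mult)
      ultimately have "ln rmin \<le> ln (lam p) - ln \<rho>" "ln (lam p) - ln \<rho> \<le> 0"
        "ln rmin \<le> ln (gam p) - ln \<rho>" "ln (gam p) - ln \<rho> \<le> 0"
        by linarith+
      moreover have "\<bar>(base p - z) / \<rho>\<bar> \<le> b"
        using pb \<rho> by (simp add: pos_divide_le_eq)
      then have "- b \<le> (base p - z) / \<rho>" "(base p - z) / \<rho> \<le> b"
        by linarith+
      moreover have "word_orient F (fst p) \<in> {1, -1}" "word_orient G (snd p) \<in> {1, -1}"
        using A.word_orient_cases[of "fst p"] B.word_orient_cases[of "snd p"] p(1) by auto
      ultimately show "cls p \<in> T"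
        unfolding cls_def T_def using t(1) by (intro SigmaI floor_div_mem)
    qed
    then show ?thesis
      unfolding Z_def[symmetric] using card_inj_on_le[OF inj _ finT] by blast
  qed
  then show ?thesis
    by blast
qed

text \<open>The mass distribution principle for finite coverings by balls.\<close>

lemma cost_lower_bound:
  assumes N: "\<And>\<rho> z. 0 < \<rho> \<Longrightarrow> \<rho> < 1 \<Longrightarrow>
      card {p \<in> pstopped \<rho> ([], []). \<bar>base p - z\<bar> \<le> (4 * R + 1) * \<rho>} \<le> N"
    and I: "finite I" "\<And>i. i \<in> I \<Longrightarrow> 0 < r i \<and> r i < 1"
    and cover: "img ([], []) \<subseteq> (\<Union>i \<in> I. ball (x i) (r i))"
  shows "1 \<le> real N * (\<Sum>i \<in> I. r i powr (d + d'))"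
proof -
  let ?o = "([], []) :: nat list \<times> nat list"
  obtain e where e: "0 < e" "e \<le> 1" "\<And>i. i \<in> I \<Longrightarrow> e \<le> r i"
    using finite_positive_lower_bound[of I r] I by metis
  \<comment> \<open>Pairs stopped at any of the radii are still larger than \<open>\<rho>\<close>.\<close>
  define \<rho> where "\<rho> = rmin * e"
  have "rmin * e \<le> rmin * 1"
    using e rmin_bounds by (intro mult_left_mono) auto
  then have \<rho>: "0 < \<rho>" "\<rho> < 1"
    unfolding \<rho>_def using e(1) rmin_bounds(1,2) mult_pos_pos[of rmin e] by linarith+
  have \<rho>_le: "\<rho> \<le> rmin * r i" "\<rho> \<le> r i" if "i \<in> I" for i
  proof -
    show "\<rho> \<le> rmin * r i"
      using e(3)[OF that] rmin_bounds by (simp add: \<rho>_def)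
    also have "\<dots> \<le> 1 * r i"
      using I(2)[OF that] rmin_bounds by (intro mult_right_mono) auto
    finally show "\<rho> \<le> r i"
      by simp
  qed
  define Q where "Q i = {q \<in> pstopped (r i) ?o. \<bar>base q - x i\<bar> \<le> (4 * R + 1) * r i}" for i
  have finQ: "finite (Q i)" if "i \<in> I" for i
    using I(2)[OF that] unfolding Q_def by (intro finite_subset[OF _ finite_pstopped[of "r i" ?o]]) auto
  have Q: "q \<in> pwords" "lam q \<le> r i" "gam q \<le> r i" "\<rho> < lam q" "\<rho> < gam q" if "i \<in> I" "q \<in> Q i" for i q
  proof -
    have "q \<in> pstopped (r i) ?o"
      using that(2) by (simp add: Q_def)
    note props = pstopped_props(1,4-7)[OF this conjunct1[OF I(2)[OF that(1)]] conjunct2[OF I(2)[OF that(1)]]]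
    then show "q \<in> pwords" "lam q \<le> r i" "gam q \<le> r i" "\<rho> < lam q" "\<rho> < gam q"
      using \<rho>_le(1)[OF that(1)] by simp_all
  qed
  have "pstopped \<rho> ?o \<subseteq> (\<Union>iq \<in> Sigma I Q. pstopped \<rho> (snd iq))"
  proof
    fix p assume p: "p \<in> pstopped \<rho> ?o"
    note props = pstopped_props[OF p \<rho>]
    have "base p \<in> img ?o"
      using base_in_img[of p] img_cat_subset[OF props(1), of ?o] by (auto simp: cat_def)
    then obtain i where i: "i \<in> I" "dist (x i) (base p) < r i"
      using cover by auto
    obtain u where u: "u \<in> stopped F (r i) []" "prefix u (fst p)"
      using A.exists_stopped_prefix[of "fst p" "[]" "r i"] props(1,4) \<rho>_le(2)[OF i(1)] I(2)[OF i(1)]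
      by (auto simp: mem_Times_iff)
    obtain v where v: "v \<in> stopped G (r i) []" "prefix v (snd p)"
      using B.exists_stopped_prefix[of "snd p" "[]" "r i"] props(1,5) \<rho>_le(2)[OF i(1)] I(2)[OF i(1)]
      by (auto simp: mem_Times_iff)
    define q where "q = (u, v)"
    have q: "q \<in> pstopped (r i) ?o"
      using u v by (simp add: q_def pstopped_def)
    note qprops = pstopped_props[OF q conjunct1[OF I(2)[OF i(1)]] conjunct2[OF I(2)[OF i(1)]]]
    obtain w1 w2 where "fst p = u @ w1" "snd p = v @ w2"
      using u(2) v(2) by (auto simp: prefix_def)
    then have p_eq: "p = cat q (w1, w2)"
      by (simp add: q_def cat_def prod_eq_iff)
    have "(w1, w2) \<in> pwords"
      using props(1) unfolding p_eq by (simp only: cat_in_pwords simp_thms)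
    then have "base p \<in> img q"
      using base_in_img[of p] img_cat_subset[of "(w1, w2)" q] unfolding p_eq by blast
    then have "\<bar>base p - base q\<bar> \<le> 2 * R * (lam q + gam q)"
      using img_subset_cball[OF qprops(1)] by (auto simp: dist_real_def abs_minus_commute)
    also have "\<dots> \<le> 2 * R * (2 * r i)"
      using qprops(4,5) R_pos by (intro mult_left_mono) auto
    finally have "\<bar>base q - x i\<bar> \<le> (4 * R + 1) * r i"
      using i(2) by (simp add: dist_real_def algebra_simps)
    then have "q \<in> Q i"
      using q by (simp add: Q_def)
    moreover have "p \<in> pstopped \<rho> q"
      using p u(2) v(2) by (auto simp: q_def pstopped_def stopped_def)
    ultimately show "p \<in> (\<Union>iq \<in> Sigma I Q. pstopped \<rho> (snd iq))"
      using i(1) by force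
  qed
  moreover have finS: "finite (Sigma I Q)"
    using I(1) finQ by (intro finite_SigmaI)
  moreover have fins: "finite (pstopped \<rho> (snd iq))" if "iq \<in> Sigma I Q" for iq
    using that Q by (intro finite_pstopped[OF \<rho>(1)]) (auto simp only: mem_Sigma_iff mem_Times_iff split_paired_all fst_conv snd_conv)
  ultimately have "sum mass (pstopped \<rho> ?o) \<le> sum mass (\<Union>iq \<in> Sigma I Q. pstopped \<rho> (snd iq))"
    by (intro sum_mono2) (auto simp: mass_def A.mass_def B.mass_def)
  also have "\<dots> \<le> (\<Sum>iq \<in> Sigma I Q. sum mass (pstopped \<rho> (snd iq)))"
    using finS fins by (intro sum_UN_le) (auto simp: mass_def A.mass_def B.mass_def)
  also have "\<dots> = (\<Sum>i \<in> I. \<Sum>q \<in> Q i. sum mass (pstopped \<rho> q))"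
    using I(1) finQ by (simp add: sum.Sigma case_prod_beta)
  also have "\<dots> \<le> (\<Sum>i \<in> I. real N * r i powr (d + d'))"
  proof (rule sum_mono)
    fix i assume i: "i \<in> I"
    have "(\<Sum>q \<in> Q i. sum mass (pstopped \<rho> q)) \<le> real (card (Q i)) * r i powr (d + d')"
    proof (rule sum_bounded_above)
      fix q assume q: "q \<in> Q i"
      show "sum mass (pstopped \<rho> q) \<le> r i powr (d + d')"
        using Q[OF i q] by (simp only: sum_mass_pstopped[OF \<rho>(1)] mass_le_powr)
    qed
    also have "\<dots> \<le> real N * r i powr (d + d')"
      using N[of "r i" "x i"] I(2)[OF i] unfolding Q_def by (intro mult_right_mono) auto
    finally show "(\<Sum>q \<in> Q i. sum mass (pstopped \<rho> q)) \<le> real N * r i powr (d + d')" .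
  qed
  finally have "sum mass (pstopped \<rho> ?o) \<le> real N * (\<Sum>i \<in> I. r i powr (d + d'))"
    by (simp add: sum_distrib_left)
  moreover have "sum mass (pstopped \<rho> ?o) = 1"
    using \<rho> by (subst sum_mass_pstopped) (auto simp: mass_def A.mass_def B.mass_def)
  ultimately show ?thesis
    by simp
qed

lemma compact_img_Nil: "compact (img ([], []))"
  using compact_sums[OF A.compact_K B.compact_K] by (simp add: img_def val_def)

end

section \<open>Hausdorff measure and coverings by balls\<close>

text \<open>
  Each covering set is enlarged to an open ball; the total increase of the sums of powers stays
  below \<open>\<eta>\<close>.
\<close>

lemma finite_ball_cover_of_hausdorff_measure_0:
  fixes E :: "real set"
  assumes "hausdorff_measure s E = 0" "compact E" "0 < s" "0 < \<eta>"
  shows "\<exists>(I :: nat set) x r. finite I \<and> (\<forall>i \<in> I. 0 < r i) \<and> E \<subseteq> (\<Union>i \<in> I. ball (x i) (r i)) \<and>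
    (\<Sum>i \<in> I. r i powr s) \<le> 2 * \<eta>"
proof -
  have "hausdorff_content s 1 E \<le> hausdorff_measure s E"
    unfolding hausdorff_measure_def by (intro SUP_upper) simp
  then have "hausdorff_content s 1 E < ennreal \<eta>"
    using assms by simp
  then obtain U :: "nat \<Rightarrow> real set" where U: "E \<subseteq> (\<Union>i. U i)" "\<And>i. bounded (U i)"
    "(\<Sum>i. diam_pow s (U i)) < ennreal \<eta>"
    unfolding hausdorff_content_def INF_less_iff by blast
  \<comment> \<open>For empty \<open>U i\<close> the center is arbitrary. The radius \<open>r i\<close> exceeds \<open>diameter (U i)\<close> slightly.\<close>
  define x where "x i = (SOME y. y \<in> U i)" for i
  define h where "h i = diameter (U i) powr s + \<eta> * (1 / 2) ^ Suc i" for i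
  define r where "r i = h i powr (1 / s)" for i
  have h: "0 < h i" for i
    using assms(4) by (simp add: h_def add_nonneg_pos)
  have r: "0 < r i" "r i powr s = h i" for i
    using h[of i] assms(3) by (simp_all add: r_def powr_powr)
  have Ur: "U i \<subseteq> ball (x i) (r i)" for i
  proof
    fix y assume y: "y \<in> U i"
    then have "x i \<in> U i"
      unfolding x_def by (rule someI)
    then have "dist (x i) y \<le> diameter (U i)"
      using y U(2) by (intro diameter_bounded_bound)
    also have "\<dots> = (diameter (U i) powr s) powr (1 / s)"
      using assms(3) diameter_ge_0[OF U(2), of i] by (simp add: powr_powr)
    also have "\<dots> < r i"
      unfolding r_def h_def using assms(3,4) by (intro powr_less_mono2) auto
    finally show "y \<in> ball (x i) (r i)"
      by simp
  qed
  have "E \<subseteq> (\<Union>i. ball (x i) (r i))"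
    using U(1) Ur by blast
  then obtain I where I: "finite I" "E \<subseteq> (\<Union>i \<in> I. ball (x i) (r i))"
    using compactE_image[OF assms(2), of UNIV "\<lambda>i. ball (x i) (r i)"] by auto
  have "diam_pow s (U i) = ennreal (diameter (U i) powr s)" for i
    using assms(3) by (simp add: diam_pow_def)
  then have "ennreal (\<Sum>i \<in> I. diameter (U i) powr s) = (\<Sum>i \<in> I. diam_pow s (U i))"
    by simp
  also have "\<dots> \<le> (\<Sum>i. diam_pow s (U i))"
    using I(1) by (intro sum_le_suminf) auto
  finally have "ennreal (\<Sum>i \<in> I. diameter (U i) powr s) < ennreal \<eta>"
    using U(3) by simp
  then have 1: "(\<Sum>i \<in> I. diameter (U i) powr s) < \<eta>"
    using assms(4) by (simp add: ennreal_less_iff sum_nonneg)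
  have "(\<Sum>i \<in> I. (1 / 2 :: real) ^ Suc i) \<le> (\<Sum>i. (1 / 2) ^ Suc i)"
    using I(1) power_half_series by (intro sum_le_suminf) (auto simp: sums_iff)
  also have "\<dots> = 1"
    using power_half_series by (simp add: sums_iff)
  finally have "\<eta> * (\<Sum>i \<in> I. (1 / 2 :: real) ^ Suc i) \<le> \<eta> * 1"
    using assms(4) by (intro mult_left_mono) auto
  then have 2: "(\<Sum>i \<in> I. \<eta> * (1 / 2 :: real) ^ Suc i) \<le> \<eta>"
    by (simp only: sum_distrib_left mult_1_right)
  have "(\<Sum>i \<in> I. r i powr s) = (\<Sum>i \<in> I. diameter (U i) powr s) + (\<Sum>i \<in> I. \<eta> * (1 / 2) ^ Suc i)"
    unfolding r(2) h_def by (rule sum.distrib)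
  also have "\<dots> \<le> 2 * \<eta>"
    using 1 2 by linarith
  finally show ?thesis
    using I r(1) by blast
qed

lemma hausdorff_measure_eq_0_of_coverable:
  fixes E :: "real set"
  assumes "0 < s" "\<And>\<eta>. 0 < \<eta> \<Longrightarrow> coverable s E \<eta>"
  shows "hausdorff_measure s E = 0"
proof -
  have content: "hausdorff_content s \<delta> E \<le> ennreal e" if "0 < \<delta>" "0 < e" for \<delta> e
  proof -
    \<comment> \<open>The second bound forces every single radius to be at most \<open>\<delta> / 2\<close>.\<close>
    define \<eta> where "\<eta> = min (e / 2 powr s) ((\<delta> / 2) powr s)"
    have \<eta>: "0 < \<eta>" "\<eta> \<le> e / 2 powr s" "\<eta> \<le> (\<delta> / 2) powr s"
      using that by (auto simp: \<eta>_def)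
    obtain xs where xs: "E \<subseteq> (\<Union>x \<in> set xs. cball (fst x) (snd x))" "\<forall>x \<in> set xs. 0 < snd x"
      "(\<Sum>x\<leftarrow>xs. snd x powr s) \<le> \<eta>"
      using assms(2)[OF \<eta>(1)] unfolding coverable_def by blast
    define n where "n = length xs"
    have sum: "(\<Sum>i<n. snd (xs ! i) powr s) \<le> \<eta>"
      using xs(3) by (simp add: sum_list_sum_nth n_def atLeast0LessThan)
    define U where "U i = (if i < n then cball (fst (xs ! i)) (snd (xs ! i)) else {})" for i
    have pos: "0 < snd (xs ! i)" if "i < n" for i
      using xs(2) that by (simp add: n_def)
    have diam: "diameter (U i) = 2 * snd (xs ! i)" if "i < n" for i
      using that pos[OF that] by (simp add: U_def)
    have small: "diameter (U i) \<le> \<delta>" for i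
    proof (cases "i < n")
      case True
      have "snd (xs ! i) powr s \<le> (\<Sum>i<n. snd (xs ! i) powr s)"
        using True by (intro member_le_sum) auto
      then have "snd (xs ! i) powr s \<le> (\<delta> / 2) powr s"
        using sum \<eta>(3) by linarith
      then have "snd (xs ! i) \<le> \<delta> / 2"
        using assms(1) \<open>0 < \<delta>\<close> powr_less_mono2[of s "\<delta> / 2" "snd (xs ! i)"] by fastforce
      then show ?thesis
        using diam[OF True] by simp
    qed (use \<open>0 < \<delta>\<close> in \<open>simp add: U_def\<close>)
    have "E \<subseteq> (\<Union>i. U i)"
    proof
      fix y assume "y \<in> E"
      then obtain x where "x \<in> set xs" "y \<in> cball (fst x) (snd x)"
        using xs(1) by blast
      moreover from this obtain i where "i < n" "x = xs ! i"
        by (auto simp: in_set_conv_nth n_def)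
      ultimately show "y \<in> (\<Union>i. U i)"
        by (auto simp: U_def)
    qed
    moreover have "bounded (U i)" for i
      by (simp add: U_def)
    ultimately have "hausdorff_content s \<delta> E \<le> (\<Sum>i. diam_pow s (U i))"
      unfolding hausdorff_content_def using small by (intro INF_lower) simp
    also have "\<dots> = (\<Sum>i<n. diam_pow s (U i))"
      by (intro suminf_finite) (auto simp: U_def diam_pow_def)
    also have "\<dots> = (\<Sum>i<n. ennreal (2 powr s * snd (xs ! i) powr s))"
    proof (intro sum.cong refl)
      fix i assume i: "i \<in> {..<n}"
      then have "U i \<noteq> {}"
        using pos[of i] by (simp add: U_def)
      then show "diam_pow s (U i) = ennreal (2 powr s * snd (xs ! i) powr s)"
        using assms(1) i diam[of i] pos[of i] by (simp add: diam_pow_def powr_mult)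
    qed
    also have "\<dots> = ennreal (2 powr s * (\<Sum>i<n. snd (xs ! i) powr s))"
      by (simp add: sum_ennreal sum_distrib_left)
    also have "2 powr s * (\<Sum>i<n. snd (xs ! i) powr s) \<le> 2 powr s * (e / 2 powr s)"
      using sum \<eta>(2) by (intro mult_left_mono) auto
    then have "ennreal (2 powr s * (\<Sum>i<n. snd (xs ! i) powr s)) \<le> ennreal e"
      by (intro ennreal_leI) simp
    finally show ?thesis .
  qed
  have "hausdorff_content s \<delta> E = 0" if "0 < \<delta>" for \<delta>
  proof -
    have "hausdorff_content s \<delta> E \<le> 0"
    proof (rule ennreal_le_epsilon)
      show "hausdorff_content s \<delta> E \<le> 0 + ennreal e" if "0 < e" for e
        using content[OF \<open>0 < \<delta>\<close> that] by simp
    qed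
    then show ?thesis
      by simp
  qed
  then have "hausdorff_measure s E = (SUP \<delta> \<in> {0::real<..}. 0)"
    unfolding hausdorff_measure_def by (intro SUP_cong) auto
  then show ?thesis
    by simp
qed

lemma hausdorff_measure_0_nonempty:
  assumes "E \<noteq> {}"
  shows "hausdorff_measure 0 E \<noteq> 0"
proof -
  have "1 \<le> (\<Sum>i. diam_pow 0 (U i))" if U: "E \<subseteq> (\<Union>i. U i)" for U :: "nat \<Rightarrow> 'a set"
  proof -
    obtain i where "U i \<noteq> {}"
      using U assms by blast
    then have "1 = sum (\<lambda>i. diam_pow 0 (U i)) {i}"
      by (simp add: diam_pow_def)
    also have "\<dots> \<le> (\<Sum>i. diam_pow 0 (U i))"
      by (intro sum_le_suminf) auto
    finally show ?thesis .
  qed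
  then have "1 \<le> hausdorff_content 0 1 E"
    unfolding hausdorff_content_def by (intro INF_greatest) blast
  also have "\<dots> \<le> hausdorff_measure 0 E"
    unfolding hausdorff_measure_def by (intro SUP_upper) simp
  finally show ?thesis
    by auto
qed

section \<open>The characterization\<close>

context ifs_pair
begin

lemma mass_Nil: "mass ([], []) = 1"
  by (simp add: mass_def A.mass_def B.mass_def)

lemma measure_eq_0:
  assumes "0 < D" "0 < d + d'"
    and H: "\<And>\<epsilon>. 0 < \<epsilon> \<Longrightarrow> \<exists>p \<in> pwords. \<exists>q \<in> pwords.
      p \<noteq> q \<and> is_square F G \<epsilon> p \<and> is_square F G \<epsilon> q \<and> relatively_close F G D \<epsilon> p q"
  shows "hausdorff_measure (d + d') (img ([], [])) = 0"
proof (rule hausdorff_measure_eq_0_of_coverable[OF assms(2)])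
  have near: "\<exists>p q. p \<noteq> q \<and> near t p q" if t: "0 < t" for t
  proof -
    \<comment> \<open>Relative closeness carries a factor \<open>D\<close> that \<open>near\<close> does not have.\<close>
    define \<epsilon> where "\<epsilon> = min t (t / D)"
    have \<epsilon>: "0 < \<epsilon>" "\<epsilon> \<le> t" "\<epsilon> \<le> t / D"
      using t assms(1) by (auto simp: \<epsilon>_def)
    obtain p q where pq: "p \<in> pwords" "q \<in> pwords" "p \<noteq> q" "is_square F G \<epsilon> p"
      "relatively_close F G D \<epsilon> p q"
      using H[OF \<epsilon>(1)] by metis
    note close = pq(5)[unfolded relatively_close_iff[OF pq(1,2)]]
    have "\<bar>base p - base q\<bar> \<le> \<epsilon> * D * Min {lam p, lam q, gam p, gam q}"
      using close by linarith
    also have "\<dots> \<le> t * lam p"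
    proof (rule mult_mono)
      show "\<epsilon> * D \<le> t"
        using \<epsilon>(3) assms(1) by (simp add: pos_le_divide_eq)
      show "0 \<le> Min {lam p, lam q, gam p, gam q}"
        using lam_pos[OF pq(1)] lam_pos[OF pq(2)] gam_pos[OF pq(1)] gam_pos[OF pq(2)] by simp
    qed (use t in simp_all)
    finally have "near t p q"
      unfolding near_def using pq(1,2) close pq(4)[unfolded is_square_iff[OF pq(1)]] \<epsilon>(2)
      by linarith
    then show ?thesis
      using pq(3) by metis
  qed
  show "coverable (d + d') (img ([], [])) \<eta>" if "0 < \<eta>" for \<eta>
    using coverable_arbitrarily_small[OF near that squarish_Nil] by (simp add: mass_Nil)
qed

lemma measure_neq_0:
  assumes none: "\<forall>p \<in> pwords. \<forall>q \<in> pwords. p \<noteq> q \<longrightarrow>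
      is_square F G \<epsilon> p \<longrightarrow> is_square F G \<epsilon> q \<longrightarrow> \<not> relatively_close F G D \<epsilon> p q"
    and "0 < \<epsilon>" "0 < D" "0 < d + d'"
  shows "hausdorff_measure (d + d') (img ([], [])) \<noteq> 0"
proof
  assume zero: "hausdorff_measure (d + d') (img ([], [])) = 0"
  obtain N :: nat where N: "\<forall>\<rho> z. 0 < \<rho> \<longrightarrow> \<rho> < 1 \<longrightarrow>
      card {p \<in> pstopped \<rho> ([], []). \<bar>base p - z\<bar> \<le> (4 * R + 1) * \<rho>} \<le> N"
    using bounded_multiplicity[where b = "4 * R + 1", OF none assms(2,3)] by blast
  define \<eta> where "\<eta> = 1 / (4 * (real N + 1))"
  have \<eta>: "0 < \<eta>" "2 * \<eta> < 1" "real N * (2 * \<eta>) < 1"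
    by (simp_all add: \<eta>_def field_simps)
  obtain I :: "nat set" and x r where I: "finite I" "\<forall>i \<in> I. 0 < r i"
    "img ([], []) \<subseteq> (\<Union>i \<in> I. ball (x i) (r i))" "(\<Sum>i \<in> I. r i powr (d + d')) \<le> 2 * \<eta>"
    using finite_ball_cover_of_hausdorff_measure_0[OF zero compact_img_Nil assms(4) \<eta>(1)] by metis
  have "0 < r i \<and> r i < 1" if i: "i \<in> I" for i
  proof -
    have "r i powr (d + d') \<le> (\<Sum>i \<in> I. r i powr (d + d'))"
      using I(1) i by (intro member_le_sum) auto
    then have "r i powr (d + d') < 1"
      using I(4) \<eta>(2) by linarith
    then have "r i < 1"
      using assms(4) ge_one_powr_ge_zero[of "r i" "d + d'"] by fastforce
    then show ?thesis
      using I(2) i by blast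
  qed
  from cost_lower_bound[OF _ I(1) this I(3), of N]
  have "1 \<le> real N * (\<Sum>i \<in> I. r i powr (d + d'))"
    using N by blast
  also have "\<dots> \<le> real N * (2 * \<eta>)"
    using I(4) by (intro mult_left_mono) auto
  finally show False
    using \<eta>(3) by simp
qed

end

theorem theorem2p1:
  fixes F G :: ifs and C\<^sub>F C\<^sub>G :: "real set" and d\<^sub>F d\<^sub>G D :: real
  assumes "contractive_ifs F" and "contractive_ifs G"
    and "is_attractor F C\<^sub>F" and "is_attractor G C\<^sub>G"
    and "is_similarity_dim F d\<^sub>F" and "is_similarity_dim G d\<^sub>G"
    and "D = max (diameter C\<^sub>F) (diameter C\<^sub>G)"
    and "D > 0 \<or> nmaps F = 1 \<and> nmaps G = 1"
  shows "hausdorff_measure (d\<^sub>G + d\<^sub>F) {x + y | x y. x \<in> C\<^sub>F \<and> y \<in> C\<^sub>G} = 0 \<longleftrightarrow>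
    (\<forall>\<epsilon>>0. \<exists>p \<in> words F \<times> words G. \<exists>q \<in> words F \<times> words G.
       p \<noteq> q \<and> is_square F G \<epsilon> p \<and> is_square F G \<epsilon> q \<and> relatively_close F G D \<epsilon> p q)"
proof -
  interpret A: self_similar F C\<^sub>F d\<^sub>F
    using assms by unfold_locales
  interpret B: self_similar G C\<^sub>G d\<^sub>G
    using assms by unfold_locales
  have "bounded (C\<^sub>F \<union> C\<^sub>G)"
    using A.compact_K B.compact_K by (simp add: compact_imp_bounded)
  then obtain R where R: "0 < R" "\<forall>x \<in> C\<^sub>F \<union> C\<^sub>G. \<bar>x\<bar> \<le> R"
    using bounded_pos[of "C\<^sub>F \<union> C\<^sub>G"] by auto
  interpret ifs_pair F C\<^sub>F d\<^sub>F G C\<^sub>G d\<^sub>G R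
    using R by unfold_locales auto
  have sumset: "{x + y | x y. x \<in> C\<^sub>F \<and> y \<in> C\<^sub>G} = img ([], [])"
    by (simp add: img_def val_def)
  show ?thesis
  proof (cases "D > 0")
    case True
    have "d\<^sub>F \<noteq> 0 \<or> d\<^sub>G \<noteq> 0"
      using True assms(7) A.dim_eq_0_imp_nmaps_eq_1 A.nmaps_eq_1_imp_diameter_0
        B.dim_eq_0_imp_nmaps_eq_1 B.nmaps_eq_1_imp_diameter_0 by auto
    then have s: "0 < d\<^sub>F + d\<^sub>G"
      using A.dim_nonneg B.dim_nonneg by linarith
    show ?thesis
      unfolding sumset add.commute[of d\<^sub>G d\<^sub>F]
    proof (intro iffI allI impI)
      fix \<epsilon> :: real assume "hausdorff_measure (d\<^sub>F + d\<^sub>G) (img ([], [])) = 0" and "0 < \<epsilon>"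
      then show "\<exists>p \<in> pwords. \<exists>q \<in> pwords.
          p \<noteq> q \<and> is_square F G \<epsilon> p \<and> is_square F G \<epsilon> q \<and> relatively_close F G D \<epsilon> p q"
        using measure_neq_0[OF _ _ True s, of \<epsilon>] by metis
    next
      assume "\<forall>\<epsilon>>0. \<exists>p \<in> pwords. \<exists>q \<in> pwords.
          p \<noteq> q \<and> is_square F G \<epsilon> p \<and> is_square F G \<epsilon> q \<and> relatively_close F G D \<epsilon> p q"
      then show "hausdorff_measure (d\<^sub>F + d\<^sub>G) (img ([], [])) = 0"
        using measure_eq_0[OF True s] by metis
    qed
  next
    case False
    then have "nmaps F = 1" "nmaps G = 1"
      using assms(8) by auto
    then have "D = 0" "d\<^sub>G + d\<^sub>F = 0"
      using assms(7) A.nmaps_eq_1_imp_diameter_0 B.nmaps_eq_1_imp_diameter_0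
        A.nmaps_eq_1_imp_dim_eq_0 B.nmaps_eq_1_imp_dim_eq_0 by auto
    \<comment> \<open>The sumset is a point of counting measure 1, and closeness fails because its bound is 0.\<close>
    then have "hausdorff_measure (d\<^sub>G + d\<^sub>F) (img ([], [])) \<noteq> 0"
      using base_in_img by (metis empty_iff hausdorff_measure_0_nonempty)
    moreover have "\<not> relatively_close F G D 1 p q" for p q
      by (simp add: relatively_close_def case_prod_beta \<open>D = 0\<close>)
    ultimately show ?thesis
      unfolding sumset using zero_less_one by metis
  qed
qed

end
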